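(* Let $\sigma = (\lambda_1, \lambda_2, \lambda_3, \lambda_4, \lambda_5)$ be a list of real numbers with $\lambda_1 \ge \lambda_2 \ge \lambda_3 \ge \lambda_4 \ge \lambda_5$ and $\sum_{i=1}^{5} \lambda_i \ge \frac{1}{2} \lambda_1$. Then $\sigma$ is the spectrum of a nonnegative symmetric $5 \times 5$ real matrix if and only if all of the following conditions hold: (1) $\lambda_1 = \max_{\lambda \in \sigma} |\lambda|$; (2) $\lambda_2 + \lambda_5 \le \sum_{i=1}^{5} \lambda_i$; (3) $\lambda_3 \le \sum_{i=1}^{5} \lambda_i$.
   Context: A matrix is nonnegative if all its entries are nonnegative real numbers. The spectrum of a matrix is the list of its eigenvalues counted with multiplicity. *)

theory Defs
  imports
    "Jordan_Normal_Form.Spectral_Radius"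
    "HOL-Computational_Algebra.Fundamental_Theorem_Algebra"
begin

definition nonnegative_mat :: "real mat \<Rightarrow> bool" where
  "nonnegative_mat A \<longleftrightarrow> (\<forall>i<dim_row A. \<forall>j<dim_col A. A $$ (i, j) \<ge> 0)"

definition symmetric_mat :: "real mat \<Rightarrow> bool" where
  "symmetric_mat A \<longleftrightarrow> A\<^sup>T = A"

text \<open>
  The eigenvalues of a real square matrix are taken in the complex numbers and listed with their
  algebraic multiplicity. The order of the list is immaterial, hence a multiset. The constant
  \<^const>\<open>spectrum\<close> of the library is the underlying set, without multiplicities.
\<close>
definition spectrum_mset :: "real mat \<Rightarrow> complex multiset" where
  "spectrum_mset A = proots (char_poly (map_mat complex_of_real A))"

lemma set_mset_spectrum_mset:
  assumes A: "A \<in> carrier_mat n n"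
  shows "set_mset (spectrum_mset A) = spectrum (map_mat complex_of_real A)"
proof -
  have C: "map_mat complex_of_real A \<in> carrier_mat n n"
    using A by simp
  have "char_poly (map_mat complex_of_real A) \<noteq> 0"
    using degree_monic_char_poly[OF C] by auto
  then show ?thesis
    unfolding spectrum_mset_def spectrum_def
    by (auto simp: eigenvalue_root_char_poly[OF C])
qed

lemma size_spectrum_mset:
  assumes "A \<in> carrier_mat n n"
  shows "size (spectrum_mset A) = n"
  unfolding spectrum_mset_def size_proots_complex
  using degree_monic_char_poly[of "map_mat complex_of_real A" n] assms by simp

definition is_spectrum_of :: "real list \<Rightarrow> real mat \<Rightarrow> bool" where
  "is_spectrum_of \<sigma> A \<longleftrightarrow> spectrum_mset A = mset (map complex_of_real \<sigma>)"

end

theory Submission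
  imports Defs
begin

text \<open>
  Sufficiency is an explicit construction: a symmetric 3 by 3 matrix with eigenvalues
  \<open>l1, l2, l3\<close> and two large diagonal entries is unfolded to size 5, each of these two
  entries absorbing one of \<open>l4, l5\<close>.

  Condition (2) is necessary because among the positive and negative parts of the two leading
  eigenvectors there are two with disjoint supports, one of them with at most two entries; the
  corresponding 2 by 2 principal submatrix has trace at least \<open>l2 + l5\<close>.

  For (3), let \<open>t\<close> be the trace and suppose \<open>l3 > T > t\<close>. The matrix \<open>M = A - T I\<close> has a
  negative diagonal \<open>- d\<close> and is positive definite on a 3-dimensional space \<open>E\<close>, which
  may be taken generic. The sign patterns of \<open>E\<close> arrange the five indices in a cycle such that,
  with \<open>N i = m i ^ 2 / (d i * d (i + 1)) - 1\<close> for the cycle entries \<open>m\<close> of \<open>M\<close>,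
  one has \<open>N (i - 1) * N (i + 1) > 1 + N i\<close>. Equality is Gauss's relation for the side
  lengths of a right-angled pentagon (here in the hyperbolic plane, \<open>N = sinh^2\<close>), so
  \<open>M\<close> dominates entrywise a matrix \<open>M0\<close>
  which is, up to the scaling by \<open>sqrt d\<close>, minus the Gram matrix of the five normals of such a
  pentagon. For a point of the plane the squared sinh-distances to any four of the five sides add up to
  at least 1, and this forces the top eigenvalue of \<open>M0\<close> up to \<open>T\<close>. Hence
  \<open>l1 - T \<ge> T > t\<close>, against \<open>l1 \<le> 2 t\<close>.
\<close>

section \<open>Diagonalization of real symmetric matrices\<close>

text \<open>The reflection in the hyperplane orthogonal to \<open>u = w - unit_vec n 0\<close>
  exchanges these two unit vectors. Being its own inverse and transpose, it serves as an orthogonal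
  similarity in the deflation below.\<close>

lemma householder_reflection:
  fixes w :: "real vec"
  assumes w: "w \<in> carrier_vec n" "w \<bullet> w = 1" and n: "0 < n"
  shows "\<exists>H \<in> carrier_mat n n. H\<^sup>T = H \<and> H * H = 1\<^sub>m n \<and> H *\<^sub>v unit_vec n 0 = w"
proof (cases "w = unit_vec n 0")
  case True
  thus ?thesis by (intro bexI[of _ "1\<^sub>m n"]) auto
next
  case False
  define u where "u = w - unit_vec n 0"
  have u: "u \<in> carrier_vec n" using w by (simp add: u_def)
  have ui: "u $ i = w $ i - (if i = 0 then 1 else 0)" if "i < n" for i
    using that w by (simp add: u_def unit_vec_def)
  define c where "c = (\<Sum>k<n. u $ k * u $ k)"
  have ww: "(\<Sum>k<n. w $ k * w $ k) = 1" using w by (simp add: scalar_prod_def atLeast0LessThan)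
  \<comment> \<open>As \<open>w\<close> has length 1, the squared length \<open>c\<close> of
    \<open>u\<close> is \<open>2 - 2 * w $ 0\<close>. This makes \<open>H\<close> send
    \<open>unit_vec n 0\<close> to \<open>unit_vec n 0 + u\<close>.\<close>
  have c: "c = - 2 * u $ 0"
  proof -
    have "c = (\<Sum>k<n. w $ k * w $ k + (if k = 0 then 1 - 2 * w $ k else 0))"
      unfolding c_def by (rule sum.cong) (auto simp: ui algebra_simps)
    also have "\<dots> = 2 - 2 * w $ 0" using n by (simp add: sum.distrib ww)
    finally show ?thesis using n by (simp add: ui)
  qed
  have "c \<noteq> 0"
  proof
    assume "c = 0"
    hence "\<forall>k<n. u $ k = 0" unfolding c_def by (subst (asm) sum_nonneg_eq_0_iff) auto
    hence "w = unit_vec n 0" using w by (intro eq_vecI) (auto simp: ui)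
    with False show False by simp
  qed
  define H where "H = mat n n (\<lambda>(i, j). (if i = j then 1 else 0) - 2 / c * u $ i * u $ j)"
  have H: "H \<in> carrier_mat n n" by (simp add: H_def)
  have "H\<^sup>T = H" by (rule eq_matI) (auto simp: H_def)
  moreover have "H * H = 1\<^sub>m n"
  proof (rule eq_matI)
    fix i j assume ij: "i < dim_row (1\<^sub>m n :: real mat)" "j < dim_col (1\<^sub>m n :: real mat)"
    have "(H * H) $$ (i, j) = (\<Sum>k<n. ((if i = k then 1 else 0) - 2 / c * u $ i * u $ k) *
      ((if k = j then 1 else 0) - 2 / c * u $ k * u $ j))"
      using ij by (simp add: H_def scalar_prod_def atLeast0LessThan)
    also have "\<dots> = (\<Sum>k<n. (if i = k then (if k = j then 1 else 0) - 2 / c * u $ k * u $ j else 0)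
      - (if k = j then 2 / c * u $ i * u $ k else 0) + 4 / c\<^sup>2 * u $ i * u $ j * (u $ k * u $ k))"
      by (rule sum.cong) (auto simp: algebra_simps power2_eq_square)
    also have "\<dots> = (if i = j then 1 else 0) - 2 / c * u $ i * u $ j - 2 / c * u $ i * u $ j
      + 4 / c\<^sup>2 * u $ i * u $ j * c"
      unfolding sum.distrib sum_subtractf using ij by (simp add: c_def sum_distrib_left)
    also have "\<dots> = (if i = j then 1 else 0)" using \<open>c \<noteq> 0\<close> by (simp add: power2_eq_square)
    finally show "(H * H) $$ (i, j) = 1\<^sub>m n $$ (i, j)" using ij by simp
  qed (simp_all add: H_def)
  moreover have "H *\<^sub>v unit_vec n 0 = w"
  proof (rule eq_vecI)
    fix i assume "i < dim_vec w"
    hence i: "i < n" using w by simp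
    have "(H *\<^sub>v unit_vec n 0) $ i =
      (\<Sum>k<n. ((if i = k then 1 else 0) - 2 / c * u $ i * u $ k) * (if k = 0 then 1 else 0))"
      using i n by (simp add: H_def scalar_prod_def atLeast0LessThan unit_vec_def)
    also have "\<dots> = (\<Sum>k<n. if k = 0 then (if i = k then 1 else 0) - 2 / c * u $ i * u $ k else 0)"
      by (rule sum.cong) auto
    also have "\<dots> = (if i = 0 then 1 else 0) - 2 / c * u $ i * u $ 0" using n by simp
    also have "\<dots> = (if i = 0 then 1 else 0) + u $ i" using \<open>c \<noteq> 0\<close> c by (simp add: field_simps)
    finally show "(H *\<^sub>v unit_vec n 0) $ i = w $ i" using i by (simp add: ui)
  qed (use H w in auto)
  ultimately show ?thesis using H by blast
qed

text \<open>Deflation: if the reflection \<open>H\<close> carries the first basis vector to a unit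
  eigenvector for \<open>e\<close>, the first column of \<open>H * A * H\<close> is \<open>e\<close>
  times that basis vector. Symmetry clears the first row as well, and the remaining block has the
  characteristic polynomial with one factor cancelled. The diagonal follows the order of
  \<open>es\<close>, so positions in a decreasing list can later be read as ranks.\<close>

lemma symmetric_orthogonal_diagonalization:
  fixes A :: "real mat"
  assumes "A \<in> carrier_mat n n" "A\<^sup>T = A" "char_poly A = (\<Prod>e\<leftarrow>es. [:- e, 1:])"
  shows "length es = n \<and> (\<exists>U \<in> carrier_mat n n. U\<^sup>T * U = 1\<^sub>m n \<and>
    U\<^sup>T * A * U = mat n n (\<lambda>(i, j). if i = j then es ! i else 0))"
  using assms
proof (induction es arbitrary: n A)
  case Nil
  with degree_monic_char_poly[of A n] have "n = 0" by auto
  thus ?case by (auto intro!: bexI[of _ "1\<^sub>m 0"])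
next
  case (Cons e es n A)
  note A = Cons.prems(1) and symA = Cons.prems(2) and cp = Cons.prems(3)
  have deg: "degree (char_poly A) = n" using degree_monic_char_poly[OF A] by auto
  have "degree (\<Prod>e\<leftarrow>e # es. [:- e, 1:]) = length (e # es)"
    by (rule degree_linear_factors)
  hence n: "n = Suc (length es)" using deg cp by simp
  define m where "m = length es"
  have nm: "n = 1 + m" using n by (simp add: m_def)
  have "poly (char_poly A) e = 0" unfolding cp by simp
  hence "eigenvalue A e" using eigenvalue_root_char_poly[OF A] by simp
  then obtain v where v: "v \<in> carrier_vec n" "v \<noteq> 0\<^sub>v n" "A *\<^sub>v v = e \<cdot>\<^sub>v v"
    unfolding eigenvalue_def eigenvector_def using A by auto
  have vv: "0 < v \<bullet> v"
  proof -
    have vv: "v \<bullet> v = (\<Sum>k<n. v $ k * v $ k)" using v by (simp add: scalar_prod_def atLeast0LessThan)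
    have "v \<bullet> v \<noteq> 0"
    proof
      assume "v \<bullet> v = 0"
      hence "\<forall>k<n. v $ k = 0" unfolding vv by (subst (asm) sum_nonneg_eq_0_iff) auto
      hence "v = 0\<^sub>v n" using v by (intro eq_vecI) auto
      with v show False by simp
    qed
    moreover have "0 \<le> v \<bullet> v" unfolding vv by (simp add: sum_nonneg)
    ultimately show ?thesis by simp
  qed
  define w where "w = (1 / sqrt (v \<bullet> v)) \<cdot>\<^sub>v v"
  have w: "w \<in> carrier_vec n" using v by (simp add: w_def)
  have ww: "w \<bullet> w = 1" using v vv by (simp add: w_def)
  have Aw: "A *\<^sub>v w = e \<cdot>\<^sub>v w"
    using v A by (simp add: w_def mult_mat_vec[OF A v(1)] smult_smult_assoc mult.commute)
  obtain H where H: "H \<in> carrier_mat n n" "H\<^sup>T = H" "H * H = 1\<^sub>m n" "H *\<^sub>v unit_vec n 0 = w"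
    using householder_reflection[OF w ww] n by auto
  define B where "B = H * A * H"
  have B: "B \<in> carrier_mat n n" using H A by (simp add: B_def)
  have symB: "B\<^sup>T = B" unfolding B_def using H A symA
    by (simp add: transpose_mult[of _ n n _ n] assoc_mult_mat[of _ n n _ n _ n])
  have sim: "similar_mat B A"
    unfolding similar_mat_def similar_mat_wit_def using H A B
    by (intro exI[of _ H]) (auto simp: B_def Let_def)
  have Hw: "H *\<^sub>v w = unit_vec n 0"
  proof -
    have "H *\<^sub>v w = (H * H) *\<^sub>v unit_vec n 0" unfolding H(4)[symmetric]
      using H by (intro assoc_mult_mat_vec[symmetric]) auto
    thus ?thesis using H by simp
  qed
  have Bu: "B *\<^sub>v unit_vec n 0 = e \<cdot>\<^sub>v unit_vec n 0"
  proof -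
    have "B *\<^sub>v unit_vec n 0 = (H * A) *\<^sub>v (H *\<^sub>v unit_vec n 0)"
      unfolding B_def using H A by (intro assoc_mult_mat_vec) auto
    also have "\<dots> = H *\<^sub>v (A *\<^sub>v w)" unfolding H(4) using H A w by (intro assoc_mult_mat_vec) auto
    also have "\<dots> = e \<cdot>\<^sub>v unit_vec n 0" unfolding Aw using H w Hw by (simp add: mult_mat_vec[OF H(1) w])
    finally show ?thesis .
  qed
  have B0: "B $$ (i, 0) = (if i = 0 then e else 0)" if "i < n" for i
  proof -
    have "B $$ (i, 0) = (B *\<^sub>v unit_vec n 0) $ i" using B that n by simp
    thus ?thesis unfolding Bu using that n by (simp add: unit_vec_def)
  qed
  have B0': "B $$ (0, i) = (if i = 0 then e else 0)" if "i < n" for i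
    using B0[OF that] symB B that n by (metis carrier_matD index_transpose_mat(1) zero_less_Suc)
  define D where "D = mat m m (\<lambda>(i, j). B $$ (Suc i, Suc j))"
  define E where "E = mat 1 1 (\<lambda>_. e)"
  have D: "D \<in> carrier_mat m m" and E: "E \<in> carrier_mat 1 1" by (simp_all add: D_def E_def)
  have Bblock: "B = four_block_mat E (0\<^sub>m 1 m) (0\<^sub>m m 1) D"
    by (rule eq_matI) (use B B0 B0' nm in \<open>auto simp: D_def E_def four_block_mat_def\<close>)
  have symD: "D\<^sup>T = D"
  proof (rule eq_matI)
    fix i j assume "i < dim_row D" "j < dim_col D"
    hence ij: "i < m" "j < m" by (simp_all add: D_def)
    have "B $$ (Suc j, Suc i) = B\<^sup>T $$ (Suc i, Suc j)" using B nm ij by simp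
    thus "D\<^sup>T $$ (i, j) = D $$ (i, j)" using ij symB by (simp add: D_def)
  qed (simp_all add: D_def)
  have "char_poly B = char_poly E * char_poly D"
    unfolding Bblock by (rule char_poly_four_block_zeros_col[OF E _ D]) simp
  moreover have "char_poly E = [:- e, 1:]"
    by (simp add: char_poly_def char_poly_matrix_def det_single E_def)
  ultimately have "[:- e, 1:] * char_poly D = [:- e, 1:] * (\<Prod>e\<leftarrow>es. [:- e, 1:])"
    using char_poly_similar[OF sim] cp by simp
  hence cpD: "char_poly D = (\<Prod>e\<leftarrow>es. [:- e, 1:])"
    by (simp only: mult_cancel_left) simp
  obtain V where V: "V \<in> carrier_mat m m" "V\<^sup>T * V = 1\<^sub>m m"
    "V\<^sup>T * D * V = mat m m (\<lambda>(i, j). if i = j then es ! i else 0)"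
    using Cons.IH[OF D symD cpD] by blast
  define W where "W = four_block_mat (1\<^sub>m 1) (0\<^sub>m 1 m) (0\<^sub>m m 1) V"
  have W: "W \<in> carrier_mat n n" unfolding W_def nm using V by (intro four_block_carrier_mat) auto
  have WT: "W\<^sup>T = four_block_mat (1\<^sub>m 1) (0\<^sub>m 1 m) (0\<^sub>m m 1) (V\<^sup>T)"
    unfolding W_def using V by (subst transpose_four_block_mat) auto
  have WW: "W\<^sup>T * W = 1\<^sub>m n"
    unfolding WT unfolding W_def nm using V
    by (subst mult_four_block_mat[of _ 1 1 _ m _ m _ _ 1 _ m]) (auto simp: four_block_one_mat)
  have WBW: "W\<^sup>T * B * W = four_block_mat E (0\<^sub>m 1 m) (0\<^sub>m m 1) (V\<^sup>T * D * V)"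
    unfolding WT unfolding W_def Bblock using V E D
    by (subst mult_four_block_mat[of _ 1 1 _ m _ m _ _ 1 _ m], auto)
       (subst mult_four_block_mat[of _ 1 1 _ m _ m _ _ 1 _ m], auto)
  define U where "U = H * W"
  have U: "U \<in> carrier_mat n n" using H W by (simp add: U_def)
  have UT: "U\<^sup>T = W\<^sup>T * H" unfolding U_def using H W by (simp add: transpose_mult[of _ n n _ n])
  have WT': "W\<^sup>T \<in> carrier_mat n n" using W by simp
  have HHX: "H * (H * X) = X" if "X \<in> carrier_mat n n" for X
    using H that by (simp add: assoc_mult_mat[of H n n H n X n, symmetric])
  note assoc = assoc_mult_mat[of _ n n _ n _ n]
  have UU: "U\<^sup>T * U = 1\<^sub>m n"
    unfolding UT unfolding U_def using H(1) W WT' WW by (simp add: assoc HHX)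
  have "U\<^sup>T * A * U = W\<^sup>T * B * W"
    unfolding UT unfolding U_def B_def using H(1) W A WT' by (simp add: assoc)
  also have "\<dots> = mat n n (\<lambda>(i, j). if i = j then (e # es) ! i else 0)"
    unfolding WBW V(3)
    by (rule eq_matI) (auto simp: four_block_mat_def E_def nm nth_Cons')
  finally show ?case using U UU n by auto
qed

text \<open>A monic complex polynomial is determined by its multiset of roots, and real polynomials
  embed injectively into complex ones. Complex spectra are thus replaced by a factorization over the
  reals.\<close>

lemma char_poly_of_is_spectrum_of:
  assumes A: "A \<in> carrier_mat n n"
  shows "is_spectrum_of \<sigma> A \<longleftrightarrow> char_poly A = (\<Prod>e\<leftarrow>\<sigma>. [:- e, 1:])"
proof -
  interpret R: map_poly_inj_comm_ring_hom complex_of_real ..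
  define p where "p = char_poly A"
  define q where "q = (\<Prod>e\<leftarrow>\<sigma>. [:- e, 1:])"
  have cp: "char_poly (map_mat complex_of_real A) = map_poly complex_of_real p"
    unfolding p_def by (rule of_real_hom.char_poly_hom[OF A])
  have nz: "map_poly complex_of_real (\<Prod>e\<leftarrow>es. [:- e, 1:]) \<noteq> 0" for es
    by (auto simp: prod_list_zero_iff)
  have proots_q: "proots (map_poly complex_of_real q) = mset (map complex_of_real \<sigma>)"
    unfolding q_def
  proof (induction \<sigma>)
    case (Cons e es)
    have "proots (map_poly complex_of_real (\<Prod>e\<leftarrow>e # es. [:- e, 1:])) =
      proots ([:- complex_of_real e, 1:] * map_poly complex_of_real (\<Prod>e\<leftarrow>es. [:- e, 1:]))"
      by (simp add: R.hom_mult del: mult_pCons_left)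
    also have "\<dots> = proots [:- complex_of_real e, 1:] + proots (map_poly complex_of_real (\<Prod>e\<leftarrow>es. [:- e, 1:]))"
      by (rule proots_mult[OF _ nz]) simp
    finally show ?case by (simp only: Cons.IH proots_linear_factor) simp
  qed simp
  have monic_p: "monic p" using degree_monic_char_poly[OF A] by (simp add: p_def)
  have monic_q: "monic q" unfolding q_def by (rule monic_prod_list) auto
  have split: "(\<Prod>x\<in>#proots (map_poly complex_of_real r). [:- x, 1:]) = map_poly complex_of_real r"
    if "monic r" for r
    using complex_poly_decompose_multiset[of "map_poly complex_of_real r"] that by simp
  have "is_spectrum_of \<sigma> A \<longleftrightarrow> proots (map_poly complex_of_real p) = proots (map_poly complex_of_real q)"
    by (simp add: is_spectrum_of_def spectrum_mset_def cp proots_q)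
  also have "\<dots> \<longleftrightarrow> p = q"
    using split[OF monic_p] split[OF monic_q] by (metis R.injectivity)
  finally show ?thesis by (simp add: p_def q_def)
qed

section \<open>Realizing spectra by unfolding\<close>

lemma sum_lessThan_5: "(\<Sum>i<5. g i) = g 0 + g 1 + g 2 + g 3 + g (4::nat)"
  for g :: "nat \<Rightarrow> 'a::comm_monoid_add"
  by (simp add: eval_nat_numeral lessThan_Suc ac_simps)

lemma det_2:
  assumes "A \<in> carrier_mat 2 2"
  shows "det A = A $$ (0,0) * A $$ (1,1) - A $$ (0,1) * A $$ (1,0)"
proof -
  have "det A = (\<Sum>i<2. A $$ (i, 0) * cofactor A i 0)"
    by (rule laplace_expansion_column[OF assms]) simp
  thus ?thesis using assms
    by (simp add: eval_nat_numeral lessThan_Suc cofactor_def mat_delete_def det_single)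
qed

lemma det_3:
  assumes "A \<in> carrier_mat 3 3"
  shows "det A = A $$ (0,0) * (A $$ (1,1) * A $$ (2,2) - A $$ (1,2) * A $$ (2,1))
    - A $$ (1,0) * (A $$ (0,1) * A $$ (2,2) - A $$ (0,2) * A $$ (2,1))
    + A $$ (2,0) * (A $$ (0,1) * A $$ (1,2) - A $$ (0,2) * A $$ (1,1))"
proof -
  have "det A = (\<Sum>i<3. A $$ (i, 0) * cofactor A i 0)"
    by (rule laplace_expansion_column[OF assms]) simp
  thus ?thesis using assms
    by (simp add: eval_nat_numeral lessThan_Suc cofactor_def mat_delete_def det_2[unfolded eval_nat_numeral])
       (simp add: algebra_simps)
qed

text \<open>Vieta's formulas: up to sign, the coefficients are the trace, the sum of the principal 2
  by 2 minors and the determinant.\<close>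

lemma char_poly_3:
  fixes l1 l2 l3 :: real
  assumes T: "T \<in> carrier_mat 3 3"
    and e1: "T $$ (0,0) + T $$ (1,1) + T $$ (2,2) = l1 + l2 + l3"
    and e2: "T $$ (0,0) * T $$ (1,1) - T $$ (0,1) * T $$ (1,0) + (T $$ (0,0) * T $$ (2,2) - T $$ (0,2) * T $$ (2,0))
      + (T $$ (1,1) * T $$ (2,2) - T $$ (1,2) * T $$ (2,1)) = l1 * l2 + l1 * l3 + l2 * l3"
    and e3: "det T = l1 * l2 * l3"
  shows "char_poly T = [:- l1, 1:] * [:- l2, 1:] * [:- l3, 1:]"
proof -
  define C where "C = char_poly_matrix T"
  have C: "C \<in> carrier_mat 3 3" using T by (simp add: C_def)
  have Cij: "C $$ (i, j) = (if i = j then [:- T $$ (i, j), 1:] else [:- T $$ (i, j):])" if "i < 3" "j < 3" for i j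
    using T that by (simp add: C_def char_poly_matrix_def)
  have "char_poly T = [:- det T,
      T $$ (0,0) * T $$ (1,1) - T $$ (0,1) * T $$ (1,0) + (T $$ (0,0) * T $$ (2,2) - T $$ (0,2) * T $$ (2,0))
      + (T $$ (1,1) * T $$ (2,2) - T $$ (1,2) * T $$ (2,1)),
      - (T $$ (0,0) + T $$ (1,1) + T $$ (2,2)), 1:]"
    unfolding char_poly_def C_def[symmetric] det_3[OF C] det_3[OF T]
    by (simp add: Cij algebra_simps)
  also have "\<dots> = [:- (l1 * l2 * l3), l1 * l2 + l1 * l3 + l2 * l3, - (l1 + l2 + l3), 1:]"
    unfolding e1 e2 e3 ..
  also have "\<dots> = [:- l1, 1:] * [:- l2, 1:] * [:- l3, 1:]" by (simp add: algebra_simps)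
  finally show ?thesis .
qed

lemma less_5: "(i < (5::nat)) \<longleftrightarrow> i = 0 \<or> i = 1 \<or> i = 2 \<or> i = 3 \<or> i = 4"
  by auto

definition mat5 :: "real list list \<Rightarrow> real mat" where
  "mat5 R = mat 5 5 (\<lambda>(i, j). R ! i ! j)"

lemma mat5_carrier [simp]: "mat5 R \<in> carrier_mat 5 5" "dim_row (mat5 R) = 5" "dim_col (mat5 R) = 5"
  by (simp_all add: mat5_def)

lemma mat5_mult:
  "mat5 R * mat5 S = mat 5 5 (\<lambda>(i, j). R ! i ! 0 * S ! 0 ! j + R ! i ! 1 * S ! 1 ! j
     + R ! i ! 2 * S ! 2 ! j + R ! i ! 3 * S ! 3 ! j + R ! i ! 4 * S ! 4 ! j)"
  by (rule eq_matI) (simp_all add: mat5_def scalar_prod_def atLeast0LessThan sum_lessThan_5)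

text \<open>
  In the basis \<open>e1 - e2, e4 - e5, e1 + e2, e3, e4 + e5\<close> the witness is block diagonal with blocks
  \<open>l4\<close>, \<open>l5\<close> and a 3 by 3 matrix similar to the symmetric one with diagonal
  \<open>a, b, c\<close> and off-diagonal entries \<open>sqrt 2 * u, sqrt 2 * v, w\<close>.
\<close>
lemma folded_realization:
  fixes l1 l2 l3 l4 l5 a b c u v w :: real
  assumes a: "\<bar>l4\<bar> \<le> a" and b: "0 \<le> b" and c: "\<bar>l5\<bar> \<le> c" and uvw: "0 \<le> u" "0 \<le> v" "0 \<le> w"
    and e1: "a + b + c = l1 + l2 + l3"
    and e2: "a * b + a * c + b * c - 2 * u\<^sup>2 - 2 * v\<^sup>2 - w\<^sup>2 = l1 * l2 + l1 * l3 + l2 * l3"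
    and e3: "a * b * c - 2 * a * v\<^sup>2 - 2 * c * u\<^sup>2 - b * w\<^sup>2 + 4 * (u * v * w) = l1 * l2 * l3"
  shows "\<exists>A \<in> carrier_mat 5 5. nonnegative_mat A \<and> symmetric_mat A \<and> is_spectrum_of [l1, l2, l3, l4, l5] A"
proof -
  define A where "A = mat5
    [[(a + l4) / 2, (a - l4) / 2, u, w / 2, w / 2],
     [(a - l4) / 2, (a + l4) / 2, u, w / 2, w / 2],
     [u, u, b, v, v],
     [w / 2, w / 2, v, (c + l5) / 2, (c - l5) / 2],
     [w / 2, w / 2, v, (c - l5) / 2, (c + l5) / 2]]"
  define B where "B = mat5 [[l4, 0, 0, 0, 0], [0, l5, 0, 0, 0], [0, 0, a, u, w], [0, 0, 2 * u, b, 2 * v], [0, 0, w, v, c]]"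
  define P where "P = mat5 [[1, 0, 1, 0, 0], [-1, 0, 1, 0, 0], [0, 0, 0, 1, 0], [0, 1, 0, 0, 1], [0, -1, 0, 0, 1]]"
  define Q where "Q = mat5 [[1/2, -1/2, 0, 0, 0], [0, 0, 0, 1/2, -1/2], [1/2, 1/2, 0, 0, 0], [0, 0, 1, 0, 0], [0, 0, 0, 1/2, 1/2]]"
  define T where "T = mat 3 3 (\<lambda>(i, j). [[a, u, w], [2 * u, b, 2 * v], [w, v, c]] ! i ! j)"
  have carrier: "A \<in> carrier_mat 5 5" "B \<in> carrier_mat 5 5" "P \<in> carrier_mat 5 5" "Q \<in> carrier_mat 5 5"
    "T \<in> carrier_mat 3 3" by (simp_all add: A_def B_def P_def Q_def T_def)
  have PQ: "P * Q = 1\<^sub>m 5" unfolding P_def Q_def mat5_mult by (rule eq_matI) (auto simp: less_5)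
  have QP: "Q * P = 1\<^sub>m 5" unfolding P_def Q_def mat5_mult by (rule eq_matI) (auto simp: less_5)
  have AP: "A * P = P * B" unfolding A_def P_def B_def mat5_mult
    by (rule eq_matI) (auto simp: less_5 field_simps)
  have "A = A * (P * Q)" using PQ carrier by simp
  also have "\<dots> = P * B * Q" by (simp only: AP assoc_mult_mat[OF carrier(1,3,4), symmetric])
  finally have "similar_mat A B"
    unfolding similar_mat_def similar_mat_wit_def using PQ QP carrier
    by (intro exI[of _ P] exI[of _ Q]) (auto simp: Let_def)
  hence "char_poly A = char_poly B" by (rule char_poly_similar)
  also have "char_poly B = [:- l4, 1:] * ([:- l5, 1:] * char_poly T)"
  proof -
    define B' where "B' = four_block_mat (mat 1 1 (\<lambda>_. l5)) (0\<^sub>m 1 3) (0\<^sub>m 3 1) T"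
    have B': "B' \<in> carrier_mat 4 4" unfolding B'_def using carrier(5)
      by (intro four_block_carrier_mat[of _ 1 1 _ 3 3, simplified]) auto
    have "B = four_block_mat (mat 1 1 (\<lambda>_. l4)) (0\<^sub>m 1 4) (0\<^sub>m 4 1) B'"
      unfolding B_def B'_def T_def mat5_def
      by (rule eq_matI) (auto simp: less_5 four_block_mat_def)
    moreover have "char_poly (mat 1 1 (\<lambda>_. l)) = [:- l, 1:]" for l :: real
      by (simp add: char_poly_def char_poly_matrix_def det_single)
    moreover have "char_poly B' = char_poly (mat 1 1 (\<lambda>_. l5)) * char_poly T"
      unfolding B'_def by (rule char_poly_four_block_zeros_col) (use carrier in auto)
    ultimately show ?thesis
      using char_poly_four_block_zeros_col[of "mat 1 1 (\<lambda>_. l4)" "0\<^sub>m 1 4" 4 B'] B' by simp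
  qed
  also have "char_poly T = [:- l1, 1:] * [:- l2, 1:] * [:- l3, 1:]"
  proof (rule char_poly_3[OF carrier(5)])
    show "det T = l1 * l2 * l3"
      unfolding det_3[OF carrier(5)] e3[symmetric]
      by (simp add: T_def power2_eq_square algebra_simps)
  qed (use e1 e2 in \<open>simp_all add: T_def power2_eq_square algebra_simps\<close>)
  finally have "char_poly A = (\<Prod>e\<leftarrow>[l1, l2, l3, l4, l5]. [:- e, 1:])"
    by (simp add: mult_ac del: mult_pCons_left mult_pCons_right)
  hence "is_spectrum_of [l1, l2, l3, l4, l5] A" using char_poly_of_is_spectrum_of[OF carrier(1)] by simp
  moreover have "nonnegative_mat A"
    unfolding nonnegative_mat_def A_def using a b c uvw by (auto simp: mat5_def less_5)
  moreover have "symmetric_mat A"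
    unfolding symmetric_mat_def A_def mat5_def by (rule eq_matI) (auto simp: less_5)
  ultimately show ?thesis using carrier by blast
qed

text \<open>The entry \<open>b\<close> takes \<open>l3\<close> if \<open>l3\<close> is nonnegative
  and is zero otherwise. In either case, if \<open>l2\<close> is large enough to absorb
  \<open>l4\<close> (respectively \<open>l5\<close>), it becomes a diagonal entry itself. If not,
  \<open>- l4\<close> (respectively \<open>- l5\<close>), the least value that suffices, becomes
  one, and off-diagonal entries restore the eigenvalues.\<close>

lemma symmetric_nonnegative_realization:
  fixes l1 l2 l3 l4 l5 :: real
  assumes dec: "l1 \<ge> l2" "l2 \<ge> l3" "l3 \<ge> l4" "l4 \<ge> l5"
    and l5: "- l5 \<le> l1"
    and c2: "l2 + l5 \<le> l1 + l2 + l3 + l4 + l5"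
    and c3: "l3 \<le> l1 + l2 + l3 + l4 + l5"
    and tr: "0 \<le> l1 + l2 + l3 + l4 + l5"
  shows "\<exists>A \<in> carrier_mat 5 5. nonnegative_mat A \<and> symmetric_mat A \<and> is_spectrum_of [l1, l2, l3, l4, l5] A"
proof (cases "0 \<le> l3")
  case l3: True
  show ?thesis
  proof (cases "- l4 \<le> l2")
    case True
    show ?thesis
      by (rule folded_realization[of l4 l2 l3 l5 l1 0 0 0]) (use True l3 dec l5 in \<open>auto simp: algebra_simps\<close>)
  next
    case False
    \<comment> \<open>A 2 by 2 block with diagonal \<open>- l4\<close>, \<open>c\<close> and
      eigenvalues \<open>l1\<close>, \<open>l2\<close>: the trace fixes \<open>c\<close>, the
      determinant fixes \<open>w\<close>. Condition (3) is what makes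
      \<open>- l5 \<le> c\<close>.\<close>
    define c where "c = l1 + l2 + l4"
    have w: "0 \<le> (- l4 - l2) * (l1 + l4)" using False dec l5 by (intro mult_nonneg_nonneg) auto
    show ?thesis
      by (rule folded_realization[of l4 "- l4" l3 l5 c 0 0 "sqrt ((- l4 - l2) * (l1 + l4))"])
        (use False l3 dec l5 c3 w in \<open>auto simp: c_def algebra_simps\<close>)
  qed
next
  case l3: False
  show ?thesis
  proof (cases "- l5 \<le> l2")
    case True
    \<comment> \<open>The block with diagonal \<open>l1 + l3\<close>, \<open>0\<close> has
      eigenvalues \<open>l1\<close>, \<open>l3\<close>; condition (2) amounts to
      \<open>- l4 \<le> l1 + l3\<close>.\<close>
    have "0 \<le> - (l1 * l3) / 2" using l3 dec l5 by (simp add: mult_nonneg_nonpos)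
    thus ?thesis
      by (intro folded_realization[of l4 "l1 + l3" 0 l5 l2 "sqrt (- (l1 * l3) / 2)" 0 0])
        (use True l3 dec c2 in \<open>auto simp: algebra_simps\<close>)
  next
    case False
    \<comment> \<open>Gluing: the 2 by 2 matrix with diagonal \<open>a\<close>, \<open>- l5\<close>
      and off-diagonal entry \<open>sqrt k\<close> has eigenvalues \<open>l1\<close>,
      \<open>l2\<close>. Its entry \<open>a\<close> is blown up to a block with diagonal
      \<open>a + l3\<close>, \<open>0\<close> and eigenvalues \<open>a\<close>, \<open>l3\<close>.
      The entry \<open>sqrt k\<close> is distributed along the unit eigenvector of this block for
      \<open>a\<close>, whose squared entries are \<open>a / d\<close> and \<open>- l3 / d\<close>.
      Nonnegativity of the trace gives \<open>- l4 \<le> a + l3\<close>.\<close>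
    define a where "a = l1 + l2 + l5"
    define d where "d = a - l3"
    define k where "k = (- l5 - l2) * (l1 + l5)"
    define u where "u = sqrt (- (a * l3) / 2)"
    define v where "v = sqrt (k * - l3 / (2 * d))"
    define w where "w = sqrt (k * a / d)"
    have a: "0 < a" and d: "0 < d" using l3 dec tr by (auto simp: a_def d_def)
    have k: "0 \<le> k" unfolding k_def using False dec l5 by (intro mult_nonneg_nonneg) auto
    have al3: "0 \<le> - (a * l3)" using a l3 by (simp add: mult_nonneg_nonpos)
    have kl3: "0 \<le> k * - l3" using k l3 by (intro mult_nonneg_nonneg) auto
    have u2: "u\<^sup>2 = - (a * l3) / 2" using al3 by (simp add: u_def)
    have u2': "2 * u\<^sup>2 = - (a * l3)" by (simp add: u2)
    have v2: "v\<^sup>2 = k * - l3 / (2 * d)" unfolding v_def using kl3 d by (intro real_sqrt_pow2 divide_nonneg_pos) auto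
    have w2: "w\<^sup>2 = k * a / d" unfolding w_def using k a d by (intro real_sqrt_pow2 divide_nonneg_pos) auto
    have nonneg: "0 \<le> u" "0 \<le> v" "0 \<le> w"
    proof -
      show "0 \<le> u" using al3 by (simp add: u_def)
      show "0 \<le> v" unfolding v_def using kl3 d by (intro real_sqrt_ge_zero divide_nonneg_pos) auto
      show "0 \<le> w" unfolding w_def using k a d by (intro real_sqrt_ge_zero divide_nonneg_pos) auto
    qed
    have uvw: "u * v * w = k * - (a * l3) / (2 * d)"
    proof (rule power2_eq_imp_eq)
      have "(u * v * w)\<^sup>2 = (- (a * l3) / 2) * (k * - l3 / (2 * d)) * (k * a / d)"
        by (simp only: power_mult_distrib u2 v2 w2)
      also have "\<dots> = (k * - (a * l3) / (2 * d))\<^sup>2" by (simp add: power2_eq_square field_simps)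
      finally show "(u * v * w)\<^sup>2 = (k * - (a * l3) / (2 * d))\<^sup>2" .
      show "0 \<le> k * - (a * l3) / (2 * d)" using k al3 d by (intro divide_nonneg_pos mult_nonneg_nonneg) auto
    qed (use nonneg in simp)
    have kab: "k = a * - l5 - l1 * l2" by (simp add: k_def a_def algebra_simps)
    have vw: "2 * v\<^sup>2 + w\<^sup>2 = k"
    proof -
      have "2 * v\<^sup>2 + w\<^sup>2 = k * (a - l3) / d" unfolding v2 w2 using d by (simp add: field_simps)
      thus ?thesis using d by (simp add: d_def)
    qed
    have e3: "4 * (u * v * w) - 2 * (a + l3) * v\<^sup>2 = - k * l3"
    proof -
      have "4 * (u * v * w) - 2 * (a + l3) * v\<^sup>2 = k * - l3 * (a - l3) / d"
        unfolding uvw v2 using d by (simp add: field_simps)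
      thus ?thesis using d by (simp add: d_def)
    qed
    show ?thesis
    proof (rule folded_realization[of l4 "a + l3" 0 l5 "- l5" u v w])
      show "(a + l3) * 0 + (a + l3) * - l5 + 0 * - l5 - 2 * u\<^sup>2 - 2 * v\<^sup>2 - w\<^sup>2 = l1 * l2 + l1 * l3 + l2 * l3"
      proof -
        have "(a + l3) * 0 + (a + l3) * - l5 + 0 * - l5 - 2 * u\<^sup>2 - 2 * v\<^sup>2 - w\<^sup>2
          = (a + l3) * - l5 - 2 * u\<^sup>2 - (2 * v\<^sup>2 + w\<^sup>2)" by simp
        thus ?thesis unfolding vw u2' kab by (simp add: a_def algebra_simps)
      qed
      show "(a + l3) * 0 * - l5 - 2 * (a + l3) * v\<^sup>2 - 2 * - l5 * u\<^sup>2 - 0 * w\<^sup>2 + 4 * (u * v * w) = l1 * l2 * l3"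
      proof -
        have "(a + l3) * 0 * - l5 - 2 * (a + l3) * v\<^sup>2 - 2 * - l5 * u\<^sup>2 - 0 * w\<^sup>2 + 4 * (u * v * w)
          = (4 * (u * v * w) - 2 * (a + l3) * v\<^sup>2) + l5 * (2 * u\<^sup>2)" by simp
        thus ?thesis unfolding e3 u2' kab by (simp add: algebra_simps)
      qed
    qed (use nonneg l3 dec tr in \<open>auto simp: a_def\<close>)
  qed
qed

section \<open>Right-angled pentagons\<close>

lemma linear_system_solvable:
  fixes K :: "nat \<Rightarrow> nat \<Rightarrow> real"
  assumes inj: "\<And>x. (\<And>i. i < n \<Longrightarrow> (\<Sum>j<n. K i j * x j) = 0) \<Longrightarrow> \<forall>i<n. x i = 0"
  shows "\<exists>x. \<forall>i<n. (\<Sum>j<n. K i j * x j) = b i"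
proof -
  define A where "A = mat n n (\<lambda>(i, j). K i j)"
  have A: "A \<in> carrier_mat n n" by (simp add: A_def)
  have Av: "(A *\<^sub>v v) $ i = (\<Sum>j<n. K i j * v $ j)" if "i < n" "v \<in> carrier_vec n" for i v
    using that by (auto simp: A_def scalar_prod_def atLeast0LessThan intro!: sum.cong)
  have "det A \<noteq> 0"
  proof
    assume "det A = 0"
    then obtain v where v: "v \<in> carrier_vec n" "v \<noteq> 0\<^sub>v n" "A *\<^sub>v v = 0\<^sub>v n"
      using det_0_iff_vec_prod_zero[OF A] by auto
    have "\<forall>i<n. v $ i = 0"
      by (rule inj, subst Av[symmetric]) (use v in auto)
    with v show False by (auto intro: eq_vecI)
  qed
  then obtain B where B: "B \<in> carrier_mat n n" "A * B = 1\<^sub>m n"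
    using det_non_zero_imp_unit[OF A] unfolding Units_def ring_mat_def by auto
  define w where "w = B *\<^sub>v vec n b"
  have w: "w \<in> carrier_vec n" using B by (simp add: w_def)
  have "A *\<^sub>v w = (A * B) *\<^sub>v vec n b"
    unfolding w_def using A B by (intro assoc_mult_mat_vec[symmetric]) auto
  hence "A *\<^sub>v w = vec n b" using B by simp
  hence "\<forall>i<n. (\<Sum>j<n. K i j * w $ j) = b i" using Av[OF _ w] by (metis index_vec)
  thus ?thesis by blast
qed

text \<open>
  The solution \<open>x\<close> of \<open>(T I - M0) x = u\<close>, where \<open>M0\<close> is the matrix of the form in
  \<open>upper\<close>, has entries proportional to those occurring in \<open>lower\<close> for a
  suitable \<open>(\<gamma>, \<alpha>, \<beta>)\<close>; testing both hypotheses on it is contradictory if \<open>\<tau> < T\<close>.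
\<close>
lemma lorentzian_form_top_eigenvalue:
  fixes u v w :: "nat \<Rightarrow> real" and n :: nat
  defines "F \<equiv> \<lambda>c x. \<Sum>i<n. c i * x i"
  assumes upper: "\<And>x. (F u x)\<^sup>2 - (F v x)\<^sup>2 - (F w x)\<^sup>2 \<le> \<tau> * (\<Sum>i<n. (x i)\<^sup>2)"
    and lower: "\<And>\<gamma> \<alpha> \<beta>. T * (\<gamma>\<^sup>2 - \<alpha>\<^sup>2 - \<beta>\<^sup>2) \<le> (\<Sum>i<n. (\<gamma> * u i - \<alpha> * v i - \<beta> * w i)\<^sup>2)"
    and T: "0 < T"
  shows "T \<le> \<tau>"
proof (rule ccontr)
  assume "\<not> T \<le> \<tau>"
  hence \<tau>: "\<tau> < T" by simp
  define K where "K i j = (if i = j then T else 0) - (u i * u j - v i * v j - w i * w j)" for i j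
  have K: "(\<Sum>j<n. K i j * x j) = T * x i - u i * F u x + v i * F v x + w i * F w x"
    if "i < n" for i x
  proof -
    have "(\<Sum>j<n. K i j * x j) = (\<Sum>j<n. (if i = j then T * x j else 0) - u i * (u j * x j)
       + v i * (v j * x j) + w i * (w j * x j))"
      by (rule sum.cong) (auto simp: K_def algebra_simps)
    also have "\<dots> = T * x i - u i * F u x + v i * F v x + w i * F w x"
      using that by (simp add: sum.distrib sum_subtractf F_def sum_distrib_left)
    finally show ?thesis .
  qed
  have form: "(\<Sum>i<n. x i * (\<Sum>j<n. K i j * x j)) =
    T * (\<Sum>i<n. (x i)\<^sup>2) - ((F u x)\<^sup>2 - (F v x)\<^sup>2 - (F w x)\<^sup>2)" for x
  proof -
    have "(\<Sum>i<n. x i * (\<Sum>j<n. K i j * x j)) = (\<Sum>i<n. T * (x i)\<^sup>2 - (u i * x i) * F u x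
      + (v i * x i) * F v x + (w i * x i) * F w x)"
      by (rule sum.cong[OF refl], subst K) (auto simp: algebra_simps power2_eq_square)
    also have "\<dots> = T * (\<Sum>i<n. (x i)\<^sup>2) - F u x * F u x + F v x * F v x + F w x * F w x"
      by (simp add: sum.distrib sum_subtractf sum_distrib_left[symmetric] sum_distrib_right[symmetric] F_def)
    finally show ?thesis by (simp add: power2_eq_square)
  qed
  have "\<exists>x. \<forall>i<n. (\<Sum>j<n. K i j * x j) = u i"
  proof (rule linear_system_solvable)
    fix x assume "\<And>i. i < n \<Longrightarrow> (\<Sum>j<n. K i j * x j) = 0"
    hence "(\<Sum>i<n. x i * (\<Sum>j<n. K i j * x j)) = 0" by simp
    with form[of x] upper[of x] have "(T - \<tau>) * (\<Sum>i<n. (x i)\<^sup>2) \<le> 0"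
      by (simp add: algebra_simps)
    hence "(\<Sum>i<n. (x i)\<^sup>2) \<le> 0" using \<tau> by (simp add: mult_le_0_iff)
    hence "(\<Sum>i<n. (x i)\<^sup>2) = 0" by (meson order_antisym sum_nonneg zero_le_power2)
    thus "\<forall>i<n. x i = 0" by (simp add: sum_nonneg_eq_0_iff)
  qed
  then obtain x where x: "\<forall>i<n. (\<Sum>j<n. K i j * x j) = u i" by blast
  have Tx: "T * x i = (1 + F u x) * u i - F v x * v i - F w x * w i" if "i < n" for i
    using K[OF that, of x] x that by (simp add: algebra_simps)
  have "(\<Sum>i<n. x i * (\<Sum>j<n. K i j * x j)) = F u x"
    using x by (simp add: F_def mult.commute)
  with form[of x] have eq: "T * (\<Sum>i<n. (x i)\<^sup>2) - ((F u x)\<^sup>2 - (F v x)\<^sup>2 - (F w x)\<^sup>2) = F u x" by simp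
  have "0 \<le> (T - \<tau>) * (\<Sum>i<n. (x i)\<^sup>2)" using \<tau> by (simp add: sum_nonneg)
  with upper[of x] eq have pos: "0 \<le> F u x" by (simp add: algebra_simps)
  have "T * (T * (\<Sum>i<n. (x i)\<^sup>2)) = (\<Sum>i<n. (T * x i)\<^sup>2)"
    by (simp add: power_mult_distrib sum_distrib_left power2_eq_square mult_ac)
  also have "\<dots> = (\<Sum>i<n. ((1 + F u x) * u i - F v x * v i - F w x * w i)\<^sup>2)"
    using Tx by simp
  also have "\<dots> \<ge> T * ((1 + F u x)\<^sup>2 - (F v x)\<^sup>2 - (F w x)\<^sup>2)" by (rule lower)
  finally have "(1 + F u x)\<^sup>2 - (F v x)\<^sup>2 - (F w x)\<^sup>2 \<le> T * (\<Sum>i<n. (x i)\<^sup>2)" using T by simp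
  \<comment> \<open>Compared with \<open>eq\<close>, the last inequality reads
    \<open>1 + F u x \<le> 0\<close>.\<close>
  with eq pos show False by (simp add: power2_eq_square algebra_simps)
qed

text \<open>
  Here \<open>\<gamma>^2 - \<alpha>^2 - \<beta>^2\<close> is the Lorentzian norm of a point, and the four squares on the right
  come from its products with the normals of four consecutive sides, in a frame adapted to the first and
  the last of them.
\<close>
lemma four_sides_bound:
  fixes p q n m \<alpha> \<beta> \<gamma> :: real
  assumes n: "n\<^sup>2 = 1 + p\<^sup>2" and m: "m\<^sup>2 = 1 + q\<^sup>2" and pq: "1 \<le> p * q"
  shows "\<gamma>\<^sup>2 - \<alpha>\<^sup>2 - \<beta>\<^sup>2 \<le> \<alpha>\<^sup>2 + (p * \<gamma> - n * \<alpha>)\<^sup>2 + (q * \<gamma> - m * \<beta>)\<^sup>2 + \<beta>\<^sup>2"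
proof -
  \<comment> \<open>Moving \<open>\<alpha>\<close> and \<open>\<beta>\<close> squared to the
    right-hand side separates these two variables. The bound below is the exact minimum over
    \<open>a\<close>, found by completing the square.\<close>
  have one: "2 * p\<^sup>2 / (3 + p\<^sup>2) * c\<^sup>2 \<le> 2 * a\<^sup>2 + (p * c - n * a)\<^sup>2"
    if n: "n\<^sup>2 = 1 + p\<^sup>2" for p n a c :: real
  proof -
    have pos: "3 + p\<^sup>2 > 0" by (simp add: add_pos_nonneg)
    have "(3 + p\<^sup>2) * (2 * a\<^sup>2 + (p * c - n * a)\<^sup>2) - 2 * p\<^sup>2 * c\<^sup>2
      = ((3 + p\<^sup>2) * a - p * n * c)\<^sup>2 + (n\<^sup>2 - 1 - p\<^sup>2) * ((3 + p\<^sup>2) * a\<^sup>2 - p\<^sup>2 * c\<^sup>2)"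
      by (simp add: power2_eq_square algebra_simps)
    hence "2 * p\<^sup>2 * c\<^sup>2 \<le> (3 + p\<^sup>2) * (2 * a\<^sup>2 + (p * c - n * a)\<^sup>2)"
      using n by (smt (verit) mult_eq_0_iff zero_le_power2)
    thus ?thesis using pos by (simp add: field_simps)
  qed
  have pos: "3 + p\<^sup>2 > 0" "3 + q\<^sup>2 > 0" by (simp_all add: add_pos_nonneg)
  \<comment> \<open>After clearing denominators this is
    \<open>3 \<le> p^2 + q^2 + p^2 * q^2\<close>, which follows from \<open>1 \<le> p * q\<close>
    and the inequality of the means.\<close>
  have "1 \<le> 2 * p\<^sup>2 / (3 + p\<^sup>2) + 2 * q\<^sup>2 / (3 + q\<^sup>2)"
  proof -
    have "1 \<le> (p * q)\<^sup>2" using pq by (simp add: one_le_power)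
    moreover have "2 * (p * q) \<le> p\<^sup>2 + q\<^sup>2" using zero_le_power2[of "p - q"]
      by (simp add: power2_eq_square algebra_simps)
    ultimately have "3 \<le> p\<^sup>2 + q\<^sup>2 + p\<^sup>2 * q\<^sup>2" using pq by (simp add: power_mult_distrib)
    hence "(3 + p\<^sup>2) * (3 + q\<^sup>2) \<le> 2 * p\<^sup>2 * (3 + q\<^sup>2) + 2 * q\<^sup>2 * (3 + p\<^sup>2)"
      by (simp add: algebra_simps)
    thus ?thesis using pos by (simp add: divide_simps) (simp add: algebra_simps)?
  qed
  hence "\<gamma>\<^sup>2 \<le> (2 * p\<^sup>2 / (3 + p\<^sup>2) + 2 * q\<^sup>2 / (3 + q\<^sup>2)) * \<gamma>\<^sup>2"
    by (simp add: mult_le_cancel_right1)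
  also have "\<dots> = 2 * p\<^sup>2 / (3 + p\<^sup>2) * \<gamma>\<^sup>2 + 2 * q\<^sup>2 / (3 + q\<^sup>2) * \<gamma>\<^sup>2"
    by (simp only: distrib_right)
  finally show ?thesis using one[OF n, of \<gamma> \<alpha>] one[OF m, of \<gamma> \<beta>] by linarith
qed

text \<open>
  The products of a point with the five normals of a right-angled pentagon, in the frame given by
  sides 1 and 4. Omitting side 5, 1 or 2 reduces to the previous lemma after changing to the
  frame of the two neighbours of the omitted side; sides 4 and 3 follow by reflection.
\<close>
lemma right_angled_pentagon_aux:
  fixes p q n m r \<alpha> \<beta> \<gamma> :: real
  assumes n: "n\<^sup>2 = 1 + p\<^sup>2" "0 < n" and m: "m\<^sup>2 = 1 + q\<^sup>2" "0 < m"
    and r: "r\<^sup>2 = p\<^sup>2 * q\<^sup>2 - 1" "0 < r" and pos: "0 < p" "0 < q"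
  defines "s1 \<equiv> \<alpha>" and "s2 \<equiv> p * \<gamma> - n * \<alpha>" and "s3 \<equiv> q * \<gamma> - m * \<beta>" and "s4 \<equiv> \<beta>"
    and "s5 \<equiv> (n * m * \<gamma> - p * m * \<alpha> - q * n * \<beta>) / r"
    and "Q \<equiv> \<gamma>\<^sup>2 - \<alpha>\<^sup>2 - \<beta>\<^sup>2"
  shows "Q \<le> s1\<^sup>2 + s2\<^sup>2 + s3\<^sup>2 + s4\<^sup>2"
    and "Q \<le> s2\<^sup>2 + s3\<^sup>2 + s4\<^sup>2 + s5\<^sup>2"
    and "Q \<le> s3\<^sup>2 + s4\<^sup>2 + s5\<^sup>2 + s1\<^sup>2"
proof -
  have nn: "n * n = 1 + p * p" "n * (n * z) = (1 + p * p) * z" for z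
    using n by (simp_all add: power2_eq_square flip: mult.assoc)
  have mm: "m * m = 1 + q * q" "m * (m * z) = (1 + q * q) * z" for z
    using m by (simp_all add: power2_eq_square flip: mult.assoc)
  have pq: "1 < (p * q)\<^sup>2" using r by (metis diff_gt_0_iff_gt power_mult_distrib zero_less_power)
  hence pq1: "1 < p * q" using pos by (smt (verit) mult_pos_pos power_le_one)
  show "Q \<le> s1\<^sup>2 + s2\<^sup>2 + s3\<^sup>2 + s4\<^sup>2"
    using four_sides_bound[OF n(1) m(1), of \<gamma> \<alpha> \<beta>] pq1 by (simp add: Q_def s1_def s2_def s3_def s4_def)
  show "Q \<le> s2\<^sup>2 + s3\<^sup>2 + s4\<^sup>2 + s5\<^sup>2"
  proof -
    \<comment> \<open>The normals of sides 2 and 5 are orthogonal, and \<open>(g, s2, s5)\<close>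
      are the coordinates of the point in the frame given by them; \<open>g\<close> is solved from
      the expression of \<open>s3\<close> in this frame. The parameters \<open>r\<close> and
      \<open>m / r\<close> take the roles of \<open>p\<close> and \<open>q\<close>.\<close>
    define g where "g = (s3 + p * q * s2) / r"
    have e1: "(p * q)\<^sup>2 = 1 + r\<^sup>2" using r by (simp add: power_mult_distrib)
    have e2: "(q * n / r)\<^sup>2 = 1 + (m / r)\<^sup>2"
    proof -
      have "q\<^sup>2 * n\<^sup>2 = r\<^sup>2 + m\<^sup>2" using n m r by (simp add: algebra_simps)
      thus ?thesis using r by (simp add: power_mult_distrib power_divide field_simps)
    qed
    have "r * g - p * q * s2 = s3" using r by (simp add: g_def)
    moreover have "m / r * g - q * n / r * s5 = s4"
    proof -
      have "m * (s3 + p * q * s2) - q * n * (n * m * \<gamma> - p * m * \<alpha> - q * n * \<beta>) = r\<^sup>2 * \<beta>"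
        (is "?l = _")
      proof -
        have "?l = m * q * \<gamma> * (1 + p\<^sup>2 - n\<^sup>2) + (q\<^sup>2 * n\<^sup>2 - m\<^sup>2) * \<beta>"
          unfolding s2_def s3_def by (simp add: algebra_simps power2_eq_square)
        thus ?thesis by (simp add: n m r algebra_simps)
      qed
      moreover have "m / r * g - q * n / r * s5 =
        (m * (s3 + p * q * s2) - q * n * (n * m * \<gamma> - p * m * \<alpha> - q * n * \<beta>)) / r\<^sup>2"
        using r by (simp add: g_def s5_def field_simps power2_eq_square)
      ultimately show ?thesis using r(2) by (simp add: s4_def)
    qed
    moreover have "g\<^sup>2 - s2\<^sup>2 - s5\<^sup>2 = Q"
    proof -
      have "(s3 + p * q * s2)\<^sup>2 - r\<^sup>2 * s2\<^sup>2 - (n * m * \<gamma> - p * m * \<alpha> - q * n * \<beta>)\<^sup>2 = r\<^sup>2 * Q"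
        unfolding s2_def s3_def Q_def r(1)
        by (simp add: power2_eq_square algebra_simps nn mm)
      moreover have "g\<^sup>2 - s2\<^sup>2 - s5\<^sup>2 =
        ((s3 + p * q * s2)\<^sup>2 - r\<^sup>2 * s2\<^sup>2 - (n * m * \<gamma> - p * m * \<alpha> - q * n * \<beta>)\<^sup>2) / r\<^sup>2"
        using r by (simp add: g_def s5_def field_simps)
      ultimately show ?thesis using r(2) by simp
    qed
    moreover have "1 \<le> r * (m / r)" using m r
      by simp (smt (verit) power_le_one zero_le_power2 pos zero_less_power)
    ultimately show ?thesis using four_sides_bound[OF e1 e2, of g s2 s5] by simp
  qed
  show "Q \<le> s3\<^sup>2 + s4\<^sup>2 + s5\<^sup>2 + s1\<^sup>2"
  proof -
    \<comment> \<open>The same with the frame of sides 3 and 1, where the parameters are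
      \<open>q\<close> and \<open>n / r\<close>.\<close>
    define g where "g = (s4 + m * s3) / q"
    have e2: "(p * m / r)\<^sup>2 = 1 + (n / r)\<^sup>2"
    proof -
      have "p\<^sup>2 * m\<^sup>2 = r\<^sup>2 + n\<^sup>2" using n m r by (simp add: algebra_simps)
      thus ?thesis using r by (simp add: power_mult_distrib power_divide field_simps)
    qed
    have "q * g - m * s3 = s4" using pos by (simp add: g_def)
    moreover have "n / r * g - p * m / r * s1 = s5"
    proof -
      have "n * (s4 + m * s3) - q * p * m * s1 = q * (n * m * \<gamma> - p * m * \<alpha> - q * n * \<beta>)"
        unfolding s4_def s3_def s1_def by (simp add: power2_eq_square algebra_simps mm)
      moreover have "q * g = s4 + m * s3" using pos by (simp add: g_def)
      moreover have "q * (n * g - p * m * s1) = n * (q * g) - q * p * m * s1" by (simp add: algebra_simps)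
      ultimately have "q * (n * g - p * m * s1) = q * (n * m * \<gamma> - p * m * \<alpha> - q * n * \<beta>)"
        by (simp only:)
      hence "n * g - p * m * s1 = n * m * \<gamma> - p * m * \<alpha> - q * n * \<beta>"
        using pos by (metis less_irrefl mult_left_cancel)
      hence "(n * g - p * m * s1) / r = s5" by (simp add: s5_def)
      thus ?thesis by (simp add: diff_divide_distrib)
    qed
    moreover have "g\<^sup>2 - s3\<^sup>2 - s1\<^sup>2 = Q"
    proof -
      have "(s4 + m * s3)\<^sup>2 - q\<^sup>2 * s3\<^sup>2 - q\<^sup>2 * s1\<^sup>2 = q\<^sup>2 * Q"
        unfolding s1_def s3_def s4_def Q_def by (simp add: power2_eq_square algebra_simps mm)
      thus ?thesis using pos by (simp add: g_def field_simps)
    qed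
    moreover have "1 \<le> q * (n / r)"
    proof -
      have "(q * n)\<^sup>2 = r\<^sup>2 + m\<^sup>2" using n m r by (simp add: power_mult_distrib algebra_simps)
      hence "r\<^sup>2 \<le> (q * n)\<^sup>2" by simp
      hence "r \<le> q * n" using power2_le_imp_le[of r "q * n"] pos n by simp
      thus ?thesis using r by simp
    qed
    ultimately show ?thesis using four_sides_bound[OF m(1) e2, of g s3 s1] by simp
  qed
qed


text \<open>Let \<open>S\<close> be the sum of all five squares. Omitting any one of them leaves at
  least \<open>Q\<close>, so each single square is at most \<open>S - Q\<close>. A combination with
  nonnegative weights of total at most \<open>T\<close> is therefore at most
  \<open>T * (S - Q)\<close>.\<close>

lemma right_angled_pentagon:
  fixes p q n m r \<alpha> \<beta> \<gamma> a1 a2 a3 a4 a5 T :: real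
  assumes nm: "n\<^sup>2 = 1 + p\<^sup>2" "0 < n" "m\<^sup>2 = 1 + q\<^sup>2" "0 < m"
    and r: "r\<^sup>2 = p\<^sup>2 * q\<^sup>2 - 1" "0 < r" and pos: "0 < p" "0 < q"
    and a: "0 \<le> a1" "0 \<le> a2" "0 \<le> a3" "0 \<le> a4" "0 \<le> a5" "a1 + a2 + a3 + a4 + a5 \<le> T"
  shows "T * (\<gamma>\<^sup>2 - \<alpha>\<^sup>2 - \<beta>\<^sup>2) \<le> (T - a1) * \<alpha>\<^sup>2 + (T - a2) * (p * \<gamma> - n * \<alpha>)\<^sup>2
    + (T - a3) * (q * \<gamma> - m * \<beta>)\<^sup>2 + (T - a4) * \<beta>\<^sup>2
    + (T - a5) * ((n * m * \<gamma> - p * m * \<alpha> - q * n * \<beta>) / r)\<^sup>2"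
proof -
  define s2 where "s2 = (p * \<gamma> - n * \<alpha>)\<^sup>2"
  define s3 where "s3 = (q * \<gamma> - m * \<beta>)\<^sup>2"
  define s5 where "s5 = ((n * m * \<gamma> - p * m * \<alpha> - q * n * \<beta>) / r)\<^sup>2"
  define Q where "Q = \<gamma>\<^sup>2 - \<alpha>\<^sup>2 - \<beta>\<^sup>2"
  define S where "S = \<alpha>\<^sup>2 + s2 + s3 + \<beta>\<^sup>2 + s5"
  have r': "r\<^sup>2 = q\<^sup>2 * p\<^sup>2 - 1" using r by (simp add: mult.commute)
  note R = right_angled_pentagon_aux[OF nm r pos, of \<gamma> \<alpha> \<beta>]
  \<comment> \<open>The reflection exchanges \<open>p\<close> with \<open>q\<close>,
    \<open>n\<close> with \<open>m\<close> and \<open>\<alpha>\<close> with \<open>\<beta>\<close>,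
    hence side 1 with 4 and side 2 with 3.\<close>
  note R' = right_angled_pentagon_aux[OF nm(3,4,1,2) r' r(2) pos(2,1), of \<gamma> \<beta> \<alpha>]
  have swap: "((m * n * \<gamma> - q * n * \<beta> - p * m * \<alpha>) / r)\<^sup>2 = s5"
    by (simp add: s5_def algebra_simps)
  have "s5 \<le> S - Q" "\<alpha>\<^sup>2 \<le> S - Q" "s2 \<le> S - Q"
    using R unfolding S_def Q_def s2_def s3_def s5_def by linarith+
  moreover have "\<beta>\<^sup>2 \<le> S - Q" "s3 \<le> S - Q"
    using R'(2,3) unfolding swap unfolding S_def Q_def s2_def s3_def by linarith+
  ultimately have le: "a1 * \<alpha>\<^sup>2 + a2 * s2 + a3 * s3 + a4 * \<beta>\<^sup>2 + a5 * s5
    \<le> a1 * (S - Q) + a2 * (S - Q) + a3 * (S - Q) + a4 * (S - Q) + a5 * (S - Q)"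
    using a by (intro add_mono mult_left_mono) auto
  have "0 \<le> S - Q" using \<open>\<alpha>\<^sup>2 \<le> S - Q\<close> zero_le_power2[of \<alpha>] by linarith
  hence "(a1 + a2 + a3 + a4 + a5) * (S - Q) \<le> T * (S - Q)"
    using a by (intro mult_right_mono) auto
  with le have "T * Q \<le> T * S - (a1 * \<alpha>\<^sup>2 + a2 * s2 + a3 * s3 + a4 * \<beta>\<^sup>2 + a5 * s5)"
    by (simp add: algebra_simps)
  thus ?thesis unfolding s2_def[symmetric] s3_def[symmetric] s5_def[symmetric] Q_def[symmetric]
    by (simp add: S_def algebra_simps)
qed

section \<open>From the pentagon to a lower bound for the top eigenvalue\<close>

text \<open>
  The three path inequalities say \<open>N1 * N3 > 1 + N2\<close>, \<open>N2 * N4 > 1 + N3\<close> and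
  \<open>N2 * N5 > 1 + N1\<close>. Keeping \<open>N2, N3\<close> and shrinking \<open>N1, N4, N5\<close> turns them into
  equalities, which is the right-angled pentagon.
\<close>
lemma pentagon_top_eigenvalue:
  fixes d1 d2 d3 d4 d5 m12 m23 m34 m45 m51 T \<tau> :: real
  assumes d: "0 < d1" "0 < d2" "0 < d3" "0 < d4" "0 < d5"
    and dT: "d1 \<le> T" "d2 \<le> T" "d3 \<le> T" "d4 \<le> T" "d5 \<le> T" "4 * T \<le> d1 + d2 + d3 + d4 + d5"
    and m: "0 \<le> m12" "0 \<le> m23" "0 \<le> m34" "0 \<le> m45" "0 \<le> m51"
    and heavy: "d1 * d2 < m12\<^sup>2" "d2 * d3 < m23\<^sup>2" "d3 * d4 < m34\<^sup>2" "d4 * d5 < m45\<^sup>2" "d5 * d1 < m51\<^sup>2"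
    and path5: "d1 * d4 * m23\<^sup>2 < (m12\<^sup>2 - d1 * d2) * (m34\<^sup>2 - d3 * d4)"
    and path1: "d2 * d5 * m34\<^sup>2 < (m23\<^sup>2 - d2 * d3) * (m45\<^sup>2 - d4 * d5)"
    and path4: "d5 * d3 * m12\<^sup>2 < (m51\<^sup>2 - d5 * d1) * (m23\<^sup>2 - d2 * d3)"
    and bound: "\<And>x1 x2 x3 x4 x5. \<lbrakk>0 \<le> x1; 0 \<le> x2; 0 \<le> x3; 0 \<le> x4; 0 \<le> x5\<rbrakk> \<Longrightarrow>
      2 * (m12 * x1 * x2 + m23 * x2 * x3 + m34 * x3 * x4 + m45 * x4 * x5 + m51 * x5 * x1)
      - (d1 * x1\<^sup>2 + d2 * x2\<^sup>2 + d3 * x3\<^sup>2 + d4 * x4\<^sup>2 + d5 * x5\<^sup>2)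
      \<le> \<tau> * (x1\<^sup>2 + x2\<^sup>2 + x3\<^sup>2 + x4\<^sup>2 + x5\<^sup>2)"
  shows "T \<le> \<tau>"
proof -
  define N1 where "N1 = m12\<^sup>2 / (d1 * d2) - 1"
  define N2 where "N2 = m23\<^sup>2 / (d2 * d3) - 1"
  define N3 where "N3 = m34\<^sup>2 / (d3 * d4) - 1"
  define N4 where "N4 = m45\<^sup>2 / (d4 * d5) - 1"
  define N5 where "N5 = m51\<^sup>2 / (d5 * d1) - 1"
  have mN: "m12\<^sup>2 = (1 + N1) * (d1 * d2)" "m23\<^sup>2 = (1 + N2) * (d2 * d3)" "m34\<^sup>2 = (1 + N3) * (d3 * d4)"
    "m45\<^sup>2 = (1 + N4) * (d4 * d5)" "m51\<^sup>2 = (1 + N5) * (d5 * d1)"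
    using d by (simp_all add: N1_def N2_def N3_def N4_def N5_def)
  have Npos: "0 < N1" "0 < N2" "0 < N3" "0 < N4" "0 < N5"
    using heavy d by (simp_all add: N1_def N2_def N3_def N4_def N5_def field_simps)
  have k13: "1 + N2 < N1 * N3"
  proof -
    have "(d1 * d2 * d3 * d4) * (1 + N2) < (d1 * d2 * d3 * d4) * (N1 * N3)"
      using path5 unfolding mN by (simp add: algebra_simps)
    thus ?thesis using d by simp
  qed
  have k24: "1 + N3 < N2 * N4"
  proof -
    have "(d2 * d3 * d4 * d5) * (1 + N3) < (d2 * d3 * d4 * d5) * (N2 * N4)"
      using path1 unfolding mN by (simp add: algebra_simps)
    thus ?thesis using d by simp
  qed
  have k25: "1 + N1 < N2 * N5"
  proof -
    have "(d5 * d1 * d2 * d3) * (1 + N1) < (d5 * d1 * d2 * d3) * (N2 * N5)"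
      using path4 unfolding mN by (simp add: algebra_simps)
    thus ?thesis using d by simp
  qed
  \<comment> \<open>With \<open>q^2 = N3\<close>, \<open>r^2 = N2\<close> and
    \<open>p^2 * q^2 = 1 + N2\<close>, the pentagon keeps \<open>N2\<close> and \<open>N3\<close>
    and has \<open>p^2 = (1 + N2) / N3\<close>, \<open>(1 + N3) / N2\<close> and
    \<open>(1 + p^2) / N2\<close> in place of \<open>N1\<close>, \<open>N4\<close> and
    \<open>N5\<close>.\<close>
  define p where "p = sqrt ((1 + N2) / N3)"
  define q where "q = sqrt N3"
  define n where "n = sqrt (1 + p\<^sup>2)"
  define m where "m = sqrt (1 + N3)"
  define r where "r = sqrt N2"
  have p2: "p\<^sup>2 = (1 + N2) / N3" and q2: "q\<^sup>2 = N3" and m2: "m\<^sup>2 = 1 + q\<^sup>2" and r2: "r\<^sup>2 = N2"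
    using Npos by (simp_all add: p_def q_def m_def r_def)
  have n2: "n\<^sup>2 = 1 + p\<^sup>2" by (simp add: n_def add_nonneg_nonneg)
  have pos: "0 < p" "0 < q" "0 < m" "0 < r" using Npos by (simp_all add: p_def q_def m_def r_def)
  have npos: "0 < n" by (simp add: n_def add_pos_nonneg)
  have p2q2: "p\<^sup>2 * q\<^sup>2 = 1 + N2" using Npos by (simp add: p2 q2)
  have r2': "r\<^sup>2 = p\<^sup>2 * q\<^sup>2 - 1" by (simp add: r2 p2q2)
  have pN1: "p\<^sup>2 \<le> N1" using k13 Npos by (simp add: p2 field_simps)
  define e1 where "e1 = sqrt d1" define e2 where "e2 = sqrt d2" define e3 where "e3 = sqrt d3"
  define e4 where "e4 = sqrt d4" define e5 where "e5 = sqrt d5"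
  note e_def = e1_def e2_def e3_def e4_def e5_def
  have e: "e1\<^sup>2 = d1" "e2\<^sup>2 = d2" "e3\<^sup>2 = d3" "e4\<^sup>2 = d4" "e5\<^sup>2 = d5" using d by (simp_all add: e_def)
  have epos: "0 < e1" "0 < e2" "0 < e3" "0 < e4" "0 < e5" using d by (simp_all add: e_def)
  define \<mu>12 where "\<mu>12 = n * e1 * e2"
  define \<mu>23 where "\<mu>23 = p * q * e2 * e3"
  define \<mu>34 where "\<mu>34 = m * e3 * e4"
  define \<mu>45 where "\<mu>45 = (q * n / r) * e4 * e5"
  define \<mu>51 where "\<mu>51 = (p * m / r) * e5 * e1"
  have le12: "\<mu>12 \<le> m12"
  proof (rule power2_le_imp_le)
    show "\<mu>12\<^sup>2 \<le> m12\<^sup>2" using d pN1 unfolding mN by (simp add: \<mu>12_def power_mult_distrib e n2)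
  qed (fact m)
  have le23: "\<mu>23 \<le> m23"
  proof (rule power2_le_imp_le)
    show "\<mu>23\<^sup>2 \<le> m23\<^sup>2" unfolding mN by (simp add: \<mu>23_def power_mult_distrib e p2q2)
  qed (fact m)
  have le34: "\<mu>34 \<le> m34"
  proof (rule power2_le_imp_le)
    show "\<mu>34\<^sup>2 \<le> m34\<^sup>2" unfolding mN by (simp add: \<mu>34_def power_mult_distrib e m2 q2)
  qed (fact m)
  have le45: "\<mu>45 \<le> m45"
  proof (rule power2_le_imp_le)
    have "q\<^sup>2 * n\<^sup>2 = 1 + N2 + N3" using p2q2 q2 by (simp add: n2 algebra_simps)
    hence "(q * n / r)\<^sup>2 = (1 + N2 + N3) / N2" by (simp add: power_divide power_mult_distrib r2)
    also have "\<dots> \<le> 1 + N4" using k24 Npos by (simp add: field_simps)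
    finally have "(q * n / r)\<^sup>2 * (d4 * d5) \<le> (1 + N4) * (d4 * d5)"
      using d by (intro mult_right_mono) auto
    thus "\<mu>45\<^sup>2 \<le> m45\<^sup>2" unfolding mN \<mu>45_def power_mult_distrib e mult.assoc .
  qed (fact m)
  have le51: "\<mu>51 \<le> m51"
  proof (rule power2_le_imp_le)
    have "p\<^sup>2 * m\<^sup>2 = 1 + N2 + p\<^sup>2" using p2q2 by (simp add: m2 algebra_simps)
    hence "(p * m / r)\<^sup>2 = (1 + N2 + p\<^sup>2) / N2" by (simp add: power_divide power_mult_distrib r2)
    also have "\<dots> \<le> 1 + N5" using k25 pN1 Npos by (simp add: field_simps)
    finally have "(p * m / r)\<^sup>2 * (d5 * d1) \<le> (1 + N5) * (d5 * d1)"
      using d by (intro mult_right_mono) auto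
    thus "\<mu>51\<^sup>2 \<le> m51\<^sup>2" unfolding mN \<mu>51_def power_mult_distrib e mult.assoc .
  qed (fact m)
  \<comment> \<open>At each index, \<open>u\<close> holds the time coordinate and \<open>v\<close>,
    \<open>w\<close> the space coordinates of one normal, scaled by the root of the matching
    \<open>d\<close>. The matrix \<open>M0\<close> is then the sum of the rank one matrices of
    \<open>u\<close>, \<open>v\<close>, \<open>w\<close> with signs plus, minus, minus, and its
    off-diagonal entries are the \<open>\<mu>\<close> above.\<close>
  define u where "u = nth [0, p * e2, q * e3, 0, n * m / r * e5]"
  define v where "v = nth [- e1, n * e2, 0, 0, p * m / r * e5]"
  define w where "w = nth [0, 0, m * e3, - e4, q * n / r * e5]"
  note uvw = u_def v_def w_def
  show "T \<le> \<tau>"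
  proof (rule lorentzian_form_top_eigenvalue[where n = 5 and u = u and v = v and w = w])
    fix x :: "nat \<Rightarrow> real"
    \<comment> \<open>\<open>bound\<close> concerns nonnegative vectors. As the off-diagonal entries
      are nonnegative, passing to absolute values can only raise the form.\<close>
    define y where "y i = \<bar>x i\<bar>" for i
    have "(\<Sum>i<5. u i * x i)\<^sup>2 - (\<Sum>i<5. v i * x i)\<^sup>2 - (\<Sum>i<5. w i * x i)\<^sup>2 =
      2 * (\<mu>12 * (x 0 * x 1) + \<mu>23 * (x 1 * x 2) + \<mu>34 * (x 2 * x 3) + \<mu>45 * (x 3 * x 4) + \<mu>51 * (x 4 * x 0))
      - (d1 * (x 0)\<^sup>2 + d2 * (x 1)\<^sup>2 + d3 * (x 2)\<^sup>2 + d4 * (x 3)\<^sup>2 + d5 * (x 4)\<^sup>2)"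
    proof -
      define X where "X = e5 * x 4 / r"
      have e5X: "e5 * x 4 = r * X" using pos by (simp add: X_def)
      have X: "d5 * (x 4)\<^sup>2 = r\<^sup>2 * X\<^sup>2" using e5X by (simp add: e(5)[symmetric] power_mult_distrib[symmetric])
      have "(\<Sum>i<5. u i * x i) = p * (e2 * x 1) + q * (e3 * x 2) + n * m * X"
        "(\<Sum>i<5. v i * x i) = - (e1 * x 0) + n * (e2 * x 1) + p * m * X"
        "(\<Sum>i<5. w i * x i) = m * (e3 * x 2) - e4 * x 3 + q * n * X"
        unfolding sum_lessThan_5 uvw X_def by simp_all
      moreover have "\<mu>45 * (x 3 * x 4) = q * n * (e4 * x 3) * X" "\<mu>51 * (x 4 * x 0) = p * m * X * (e1 * x 0)"
        by (simp_all add: \<mu>45_def \<mu>51_def X_def)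
      moreover have "(p * y2 + q * y3 + n * m * X)\<^sup>2 - (- y1 + n * y2 + p * m * X)\<^sup>2 - (m * y3 - y4 + q * n * X)\<^sup>2 =
        2 * (n * (y1 * y2) + p * q * (y2 * y3) + m * (y3 * y4) + q * n * y4 * X + p * m * X * y1)
        - (y1\<^sup>2 + y2\<^sup>2 + y3\<^sup>2 + y4\<^sup>2 + r\<^sup>2 * X\<^sup>2)" for y1 y2 y3 y4
      proof -
        have "(p * y2 + q * y3 + n * m * X)\<^sup>2 - (- y1 + n * y2 + p * m * X)\<^sup>2 - (m * y3 - y4 + q * n * X)\<^sup>2 =
          2 * (n * (y1 * y2) + p * q * (y2 * y3) + m * (y3 * y4) + q * n * y4 * X + p * m * X * y1)
          - (y1\<^sup>2 + (n\<^sup>2 - p\<^sup>2) * y2\<^sup>2 + (m\<^sup>2 - q\<^sup>2) * y3\<^sup>2 + y4\<^sup>2 + (p\<^sup>2 * m\<^sup>2 + q\<^sup>2 * n\<^sup>2 - n\<^sup>2 * m\<^sup>2) * X\<^sup>2)"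
          by (simp add: power2_eq_square algebra_simps)
        moreover have "n\<^sup>2 - p\<^sup>2 = 1" "m\<^sup>2 - q\<^sup>2 = 1" "p\<^sup>2 * m\<^sup>2 + q\<^sup>2 * n\<^sup>2 - n\<^sup>2 * m\<^sup>2 = r\<^sup>2"
          by (simp_all add: n2 m2 r2' algebra_simps)
        ultimately show ?thesis by simp
      qed
      ultimately have "(\<Sum>i<5. u i * x i)\<^sup>2 - (\<Sum>i<5. v i * x i)\<^sup>2 - (\<Sum>i<5. w i * x i)\<^sup>2 =
          2 * (n * ((e1 * x 0) * (e2 * x 1)) + p * q * ((e2 * x 1) * (e3 * x 2)) + m * ((e3 * x 2) * (e4 * x 3))
            + \<mu>45 * (x 3 * x 4) + \<mu>51 * (x 4 * x 0))
          - ((e1 * x 0)\<^sup>2 + (e2 * x 1)\<^sup>2 + (e3 * x 2)\<^sup>2 + (e4 * x 3)\<^sup>2 + r\<^sup>2 * X\<^sup>2)"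
        by (simp only:)
      thus ?thesis unfolding X \<mu>12_def \<mu>23_def \<mu>34_def power_mult_distrib e
        by (simp add: algebra_simps)
    qed
    also have "\<dots> \<le> 2 * (m12 * (y 0 * y 1) + m23 * (y 1 * y 2) + m34 * (y 2 * y 3) + m45 * (y 3 * y 4) + m51 * (y 4 * y 0))
      - (d1 * (x 0)\<^sup>2 + d2 * (x 1)\<^sup>2 + d3 * (x 2)\<^sup>2 + d4 * (x 3)\<^sup>2 + d5 * (x 4)\<^sup>2)"
    proof -
      have *: "\<mu> * (x i * x j) \<le> c * (y i * y j)" if "0 \<le> \<mu>" "\<mu> \<le> c" for \<mu> c i j
      proof -
        have "\<mu> * (x i * x j) \<le> \<mu> * (y i * y j)"
          using that unfolding y_def by (intro mult_left_mono) (simp_all flip: abs_mult)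
        also have "\<dots> \<le> c * (y i * y j)" using that by (intro mult_right_mono) (auto simp: y_def)
        finally show ?thesis .
      qed
      have nonneg: "0 \<le> \<mu>12" "0 \<le> \<mu>23" "0 \<le> \<mu>34" "0 \<le> \<mu>45" "0 \<le> \<mu>51"
        using pos npos epos by (simp_all add: \<mu>12_def \<mu>23_def \<mu>34_def \<mu>45_def \<mu>51_def)
      show ?thesis
        by (intro diff_right_mono mult_left_mono add_mono *[OF nonneg(1) le12] *[OF nonneg(2) le23]
          *[OF nonneg(3) le34] *[OF nonneg(4) le45] *[OF nonneg(5) le51]) simp
    qed
    also have "\<dots> \<le> \<tau> * (\<Sum>i<5. (x i)\<^sup>2)"
      using bound[of "y 0" "y 1" "y 2" "y 3" "y 4"] unfolding sum_lessThan_5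
      by (simp add: y_def mult_ac)
    finally show "(\<Sum>i<5. u i * x i)\<^sup>2 - (\<Sum>i<5. v i * x i)\<^sup>2 - (\<Sum>i<5. w i * x i)\<^sup>2
      \<le> \<tau> * (\<Sum>i<5. (x i)\<^sup>2)" .
  next
    fix \<gamma> \<alpha> \<beta> :: real
    \<comment> \<open>The weights are the differences \<open>T - d1\<close> to
      \<open>T - d5\<close>, whose sum is at most \<open>T\<close> because the sum of the
      \<open>d\<close> is at least \<open>4 * T\<close>.\<close>
    have "T * (\<gamma>\<^sup>2 - \<alpha>\<^sup>2 - \<beta>\<^sup>2) \<le> (T - (T - d1)) * \<alpha>\<^sup>2 + (T - (T - d2)) * (p * \<gamma> - n * \<alpha>)\<^sup>2
      + (T - (T - d3)) * (q * \<gamma> - m * \<beta>)\<^sup>2 + (T - (T - d4)) * \<beta>\<^sup>2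
      + (T - (T - d5)) * ((n * m * \<gamma> - p * m * \<alpha> - q * n * \<beta>) / r)\<^sup>2"
      by (rule right_angled_pentagon[OF n2 npos m2 pos(3) r2' pos(4) pos(1,2)]) (use dT in auto)
    also have "\<dots> = (\<Sum>i<5. (\<gamma> * u i - \<alpha> * v i - \<beta> * w i)\<^sup>2)"
    proof -
      have "\<gamma> * u 0 - \<alpha> * v 0 - \<beta> * w 0 = e1 * \<alpha>" "\<gamma> * u 1 - \<alpha> * v 1 - \<beta> * w 1 = e2 * (p * \<gamma> - n * \<alpha>)"
        "\<gamma> * u 2 - \<alpha> * v 2 - \<beta> * w 2 = e3 * (q * \<gamma> - m * \<beta>)" "\<gamma> * u 3 - \<alpha> * v 3 - \<beta> * w 3 = e4 * \<beta>"
        "\<gamma> * u 4 - \<alpha> * v 4 - \<beta> * w 4 = e5 * ((n * m * \<gamma> - p * m * \<alpha> - q * n * \<beta>) / r)"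
        using pos by (simp_all add: uvw field_simps)
      hence "(\<Sum>i<5. (\<gamma> * u i - \<alpha> * v i - \<beta> * w i)\<^sup>2) = (e1 * \<alpha>)\<^sup>2 + (e2 * (p * \<gamma> - n * \<alpha>))\<^sup>2
        + (e3 * (q * \<gamma> - m * \<beta>))\<^sup>2 + (e4 * \<beta>)\<^sup>2
        + (e5 * ((n * m * \<gamma> - p * m * \<alpha> - q * n * \<beta>) / r))\<^sup>2"
        unfolding sum_lessThan_5 by (simp only:)
      thus ?thesis unfolding power_mult_distrib e by simp
    qed
    finally show "T * (\<gamma>\<^sup>2 - \<alpha>\<^sup>2 - \<beta>\<^sup>2) \<le> (\<Sum>i<5. (\<gamma> * u i - \<alpha> * v i - \<beta> * w i)\<^sup>2)" .
  qed (use d dT in linarith)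
qed

section \<open>Sign patterns of a three-dimensional positive subspace\<close>

text \<open>Behind this is a vector with entries \<open>ya\<close>, \<open>yb\<close>,
  \<open>- yc\<close>, \<open>- yd\<close> at which the two diagonal blocks of the form share the
  value \<open>A\<close>; \<open>gt\<close> is positivity of the form there. Completing the square
  gives \<open>da * A \<le> (mab^2 - da * db) * yb^2\<close> and its analogues. Multiplying one such
  bound from each pair, with a single cross term below \<open>A\<close>, gives the last four
  claims.\<close>

lemma split_inequalities:
  fixes da db dc dd mab mcd mac mad mbc mbd ya yb yc yd :: real
  assumes d: "0 < da" "0 < db" "0 < dc" "0 < dd"
    and m: "0 \<le> mac" "0 \<le> mad" "0 \<le> mbc" "0 \<le> mbd" "0 \<le> mab" "0 \<le> mcd"
    and y: "0 \<le> ya" "0 \<le> yb" "0 \<le> yc" "0 \<le> yd"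
    and eq: "2 * mab * ya * yb - da * ya\<^sup>2 - db * yb\<^sup>2 = 2 * mcd * yc * yd - dc * yc\<^sup>2 - dd * yd\<^sup>2"
    and gt: "mac * ya * yc + mad * ya * yd + mbc * yb * yc + mbd * yb * yd
      < 2 * mab * ya * yb - da * ya\<^sup>2 - db * yb\<^sup>2"
  shows "da * db < mab\<^sup>2" and "dc * dd < mcd\<^sup>2"
    and "da * dd * mbc\<^sup>2 < (mab\<^sup>2 - da * db) * (mcd\<^sup>2 - dc * dd)"
    and "da * dc * mbd\<^sup>2 < (mab\<^sup>2 - da * db) * (mcd\<^sup>2 - dc * dd)"
    and "db * dd * mac\<^sup>2 < (mab\<^sup>2 - da * db) * (mcd\<^sup>2 - dc * dd)"
    and "db * dc * mad\<^sup>2 < (mab\<^sup>2 - da * db) * (mcd\<^sup>2 - dc * dd)"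
proof -
  define A where "A = 2 * mab * ya * yb - da * ya\<^sup>2 - db * yb\<^sup>2"
  define X where "X = mab\<^sup>2 - da * db"
  define Z where "Z = mcd\<^sup>2 - dc * dd"
  have terms: "0 \<le> mac * ya * yc" "0 \<le> mad * ya * yd" "0 \<le> mbc * yb * yc" "0 \<le> mbd * yb * yd"
    using m y by simp_all
  have cross: "mac * ya * yc < A" "mad * ya * yd < A" "mbc * yb * yc < A" "mbd * yb * yd < A"
    using gt terms unfolding A_def by linarith+
  have A: "0 < A" using cross(1) terms(1) by linarith
  have le: "d * (2 * c * s * t - d * s\<^sup>2 - e * t\<^sup>2) \<le> (c\<^sup>2 - d * e) * t\<^sup>2" for d e c s t :: real
    using zero_le_power2[of "d * s - c * t"] by (simp add: power2_eq_square algebra_simps)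
  have 1: "da * A \<le> X * yb\<^sup>2" using le[of da mab ya yb db] by (simp add: A_def X_def)
  have 2: "db * A \<le> X * ya\<^sup>2" using le[of db mab yb ya da] by (simp add: A_def X_def algebra_simps)
  have A': "A = 2 * mcd * yc * yd - dc * yc\<^sup>2 - dd * yd\<^sup>2" using eq by (simp add: A_def)
  have 3: "dc * A \<le> Z * yd\<^sup>2" using le[of dc mcd yc yd dd] by (simp add: A' Z_def)
  have 4: "dd * A \<le> Z * yc\<^sup>2" using le[of dd mcd yd yc dc] by (simp add: A' Z_def algebra_simps)
  have pos: "0 < X * yb\<^sup>2" "0 < X * ya\<^sup>2" "0 < Z * yd\<^sup>2" "0 < Z * yc\<^sup>2"
    using 1 2 3 4 d A by (meson less_le_trans mult_pos_pos)+
  hence XZ: "0 < X" "0 < Z" by (auto simp: zero_less_mult_iff)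
  have key: "e1 * e2 * \<mu>\<^sup>2 < X * Z"
    if "e1 * A \<le> X * s\<^sup>2" "e2 * A \<le> Z * t\<^sup>2" "0 < e1" "0 < e2" "\<mu> * s * t < A" "0 \<le> \<mu> * s * t"
      "0 < X * s\<^sup>2" "0 < Z * t\<^sup>2" for e1 e2 \<mu> s t
  proof -
    have "(\<mu> * s * t)\<^sup>2 < A\<^sup>2" using that by (intro power_strict_mono) auto
    hence "e1 * e2 * (\<mu> * s * t)\<^sup>2 < e1 * e2 * A\<^sup>2" using that by simp
    also have "\<dots> = (e1 * A) * (e2 * A)" by (simp add: power2_eq_square)
    also have "\<dots> \<le> (X * s\<^sup>2) * (Z * t\<^sup>2)" by (rule mult_mono[OF that(1,2)]) (use that A in auto)
    finally have "(s * t)\<^sup>2 * (e1 * e2 * \<mu>\<^sup>2) < (s * t)\<^sup>2 * (X * Z)"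
      by (simp add: power_mult_distrib mult_ac)
    thus ?thesis by (simp add: mult_less_cancel_left)
  qed
  show "da * db < mab\<^sup>2" "dc * dd < mcd\<^sup>2" using XZ by (simp_all add: X_def Z_def)
  show "da * dd * mbc\<^sup>2 < (mab\<^sup>2 - da * db) * (mcd\<^sup>2 - dc * dd)"
    using key[OF 1 4 d(1,4) cross(3) terms(3) pos(1,4)] by (simp add: X_def Z_def)
  show "da * dc * mbd\<^sup>2 < (mab\<^sup>2 - da * db) * (mcd\<^sup>2 - dc * dd)"
    using key[OF 1 3 d(1,3) cross(4) terms(4) pos(1,3)] by (simp add: X_def Z_def)
  show "db * dd * mac\<^sup>2 < (mab\<^sup>2 - da * db) * (mcd\<^sup>2 - dc * dd)"
    using key[OF 2 4 d(2,4) cross(1) terms(1) pos(2,4)] by (simp add: X_def Z_def)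
  show "db * dc * mad\<^sup>2 < (mab\<^sup>2 - da * db) * (mcd\<^sup>2 - dc * dd)"
    using key[OF 2 3 d(2,3) cross(2) terms(2) pos(2,3)] by (simp add: X_def Z_def)
qed

definition qform :: "nat \<Rightarrow> (nat \<Rightarrow> nat \<Rightarrow> real) \<Rightarrow> (nat \<Rightarrow> real) \<Rightarrow> real" where
  "qform n M x = (\<Sum>i<n. \<Sum>j<n. M i j * x i * x j)"

lemma sum_supported_4:
  fixes F :: "nat \<Rightarrow> real"
  assumes "distinct [a, b, c, d]" "a < n" "b < n" "c < n" "d < n"
    and "\<And>i. i \<notin> {a, b, c, d} \<Longrightarrow> F i = 0"
  shows "(\<Sum>i<n. F i) = F a + F b + F c + F d"
proof -
  have "(\<Sum>i<n. F i) = (\<Sum>i\<in>{a, b, c, d}. F i)"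
    by (rule sum.mono_neutral_right) (use assms in auto)
  also have "\<dots> = F a + F b + F c + F d" using assms(1) by simp
  finally show ?thesis .
qed

text \<open>The Pluecker coordinates of the pair \<open>f\<close>, \<open>g\<close>.\<close>

definition minor :: "(nat \<Rightarrow> real) \<Rightarrow> (nat \<Rightarrow> real) \<Rightarrow> nat \<Rightarrow> nat \<Rightarrow> real" where
  "minor f g i j = f i * g j - f j * g i"

text \<open>
  Let \<open>E\<close> be the common kernel of \<open>f\<close> and \<open>g\<close>. Up to scaling, the vector of \<open>E\<close>
  supported on \<open>{i, j, k}\<close> has the entries \<open>minor j k, minor k i, minor i j\<close>. With \<open>S\<close>
  the sign of the minors, \<open>crossing\<close> says that the one on \<open>{b, c, d}\<close> separates \<open>b\<close>
  from \<open>c, d\<close> and the one on \<open>{a, b, d}\<close> separates \<open>a, b\<close> from \<open>d\<close>.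
\<close>
definition crossing :: "(nat \<Rightarrow> nat \<Rightarrow> bool) \<Rightarrow> nat \<Rightarrow> nat \<Rightarrow> nat \<Rightarrow> nat \<Rightarrow> bool" where
  "crossing S a b c d \<longleftrightarrow> S c d \<noteq> S d b \<and> S b c \<noteq> S c d \<and> S b d = S d a \<and> S a b \<noteq> S d a"

text \<open>\<open>crossing\<close> depends on the order inside each of the pairs
  \<open>a, b\<close> and \<open>c, d\<close>; its consequence \<open>split_pair\<close> does not
  when \<open>M\<close> is symmetric.\<close>

definition separated :: "(nat \<Rightarrow> nat \<Rightarrow> bool) \<Rightarrow> nat \<Rightarrow> nat \<Rightarrow> nat \<Rightarrow> nat \<Rightarrow> bool" where
  "separated S a b c d \<longleftrightarrow>
    crossing S a b c d \<or> crossing S b a c d \<or> crossing S a b d c \<or> crossing S b a d c"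

text \<open>For a negative diagonal, dividing by its entries turns this into
  \<open>N a b > 0\<close>, \<open>N c d > 0\<close> and \<open>N a b * N c d > 1 + N i j\<close>
  for the four edges joining the pairs, where
  \<open>N i j = (M i j)^2 / (M i i * M j j) - 1\<close>.\<close>

definition split_pair :: "(nat \<Rightarrow> nat \<Rightarrow> real) \<Rightarrow> nat \<Rightarrow> nat \<Rightarrow> nat \<Rightarrow> nat \<Rightarrow> bool" where
  "split_pair M a b c d \<longleftrightarrow> M a a * M b b < (M a b)\<^sup>2 \<and> M c c * M d d < (M c d)\<^sup>2 \<and>
    (\<forall>(i, i') \<in> {(a, b), (b, a)}. \<forall>(j, j') \<in> {(c, d), (d, c)}.
      M i' i' * M j' j' * (M i j)\<^sup>2 < ((M a b)\<^sup>2 - M a a * M b b) * ((M c d)\<^sup>2 - M c c * M d d))"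

text \<open>
  On the segment between the two vectors of a crossing, the signs split as \<open>a, b\<close> against
  \<open>c, d\<close>. The form restricted to \<open>{a, b}\<close> is nonpositive at the first vector, the one restricted
  to \<open>{c, d}\<close> at the second, so somewhere in between they agree.
\<close>
lemma crossing_imp_split_pair:
  fixes M :: "nat \<Rightarrow> nat \<Rightarrow> real"
  assumes pos: "\<And>x. (\<exists>i<n. x i \<noteq> 0) \<Longrightarrow> (\<Sum>i<n. f i * x i) = 0 \<Longrightarrow> (\<Sum>i<n. g i * x i) = 0
      \<Longrightarrow> 0 < qform n M x"
    and sym: "\<And>i j. i < n \<Longrightarrow> j < n \<Longrightarrow> M i j = M j i"
    and off: "\<And>i j. i < n \<Longrightarrow> j < n \<Longrightarrow> i \<noteq> j \<Longrightarrow> 0 \<le> M i j"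
    and diag: "\<And>i. i < n \<Longrightarrow> M i i < 0"
    and nz: "\<And>i j. i < n \<Longrightarrow> j < n \<Longrightarrow> i \<noteq> j \<Longrightarrow> minor f g i j \<noteq> 0"
    and abcd: "distinct [a, b, c, d]" "a < n" "b < n" "c < n" "d < n"
    and cr: "crossing (\<lambda>i j. 0 < minor f g i j) a b c d"
  shows "split_pair M a b c d"
proof -
  define \<chi> where "\<chi> = minor f g"
  have nz': "\<chi> c d \<noteq> 0" "\<chi> d b \<noteq> 0" "\<chi> b c \<noteq> 0" "\<chi> b d \<noteq> 0" "\<chi> d a \<noteq> 0" "\<chi> a b \<noteq> 0"
    using nz abcd by (auto simp: \<chi>_def)
  have s: "\<chi> d b * \<chi> c d < 0" "\<chi> b c * \<chi> c d < 0" "0 < \<chi> b d * \<chi> d a" "\<chi> a b * \<chi> d a < 0"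
    using cr nz' unfolding crossing_def \<chi>_def[symmetric]
    by (auto simp: mult_less_0_iff zero_less_mult_iff not_less)
  \<comment> \<open>At \<open>t = 0\<close> this is the kernel vector on \<open>{b, c, d}\<close>
    multiplied by \<open>\<chi> c d\<close>, at \<open>t = 1\<close> the one on
    \<open>{a, b, d}\<close> multiplied by \<open>\<chi> d a\<close>. The factors make the entry at
    \<open>b\<close> a square; \<open>crossing\<close> then determines the other signs.\<close>
  define ya where "ya t = t * (\<chi> b d * \<chi> d a)" for t :: real
  define yb where "yb t = (1 - t) * (\<chi> c d)\<^sup>2 + t * (\<chi> d a)\<^sup>2" for t :: real
  define yc where "yc t = (1 - t) * - (\<chi> d b * \<chi> c d)" for t :: real
  define yd where "yd t = (1 - t) * - (\<chi> b c * \<chi> c d) + t * - (\<chi> a b * \<chi> d a)" for t :: real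
  note y_def = ya_def yb_def yc_def yd_def
  define \<alpha> where "\<alpha> t = 2 * M a b * ya t * yb t + M a a * (ya t)\<^sup>2 + M b b * (yb t)\<^sup>2" for t
  define \<gamma> where "\<gamma> t = 2 * M c d * yc t * yd t + M c c * (yc t)\<^sup>2 + M d d * (yd t)\<^sup>2" for t
  define \<beta> where "\<beta> t = M a c * ya t * yc t + M a d * ya t * yd t + M b c * yb t * yc t + M b d * yb t * yd t" for t
  have y0: "0 \<le> ya t" "0 < yb t" "0 \<le> yc t" "0 < yd t" if "0 \<le> t" "t \<le> 1" for t
  proof -
    show "0 \<le> ya t" "0 \<le> yc t" using that s by (auto simp: y_def mult_nonneg_nonpos)
    have *: "0 < (1 - t) * u + t * v" if "0 < u" "0 < v" for u v
      using that \<open>0 \<le> t\<close> \<open>t \<le> 1\<close> by (cases "t = 1") (auto intro: add_pos_nonneg)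
    show "0 < yb t" unfolding y_def by (rule *) (use nz' in auto)
    show "0 < yd t" unfolding y_def by (rule *) (use s in auto)
  qed
  have gt: "2 * \<beta> t < \<alpha> t + \<gamma> t" if "0 \<le> t" "t \<le> 1" for t
  proof -
    define x where "x i = (if i = a then ya t else if i = b then yb t else if i = c then - yc t
      else if i = d then - yd t else 0)" for i
    have xs: "x a = ya t" "x b = yb t" "x c = - yc t" "x d = - yd t" using abcd by (auto simp: x_def)
    have x0: "x i = 0" if "i \<notin> {a, b, c, d}" for i using that by (auto simp: x_def)
    note S = sum_supported_4[OF abcd]
    have "0 < qform n M x"
    proof (rule pos)
      show "\<exists>i<n. x i \<noteq> 0" using xs(2) y0(2)[OF that] abcd by (metis less_irrefl)
      have "(\<Sum>i<n. f i * x i) = f a * x a + f b * x b + f c * x c + f d * x d" by (rule S) (simp add: x0)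
      also have "\<dots> = 0" unfolding xs y_def \<chi>_def minor_def by (simp add: power2_eq_square algebra_simps)
      finally show "(\<Sum>i<n. f i * x i) = 0" .
      have "(\<Sum>i<n. g i * x i) = g a * x a + g b * x b + g c * x c + g d * x d" by (rule S) (simp add: x0)
      also have "\<dots> = 0" unfolding xs y_def \<chi>_def minor_def by (simp add: power2_eq_square algebra_simps)
      finally show "(\<Sum>i<n. g i * x i) = 0" .
    qed
    also have "qform n M x = \<alpha> t + \<gamma> t - 2 * \<beta> t"
    proof -
      have "(\<Sum>j<n. M i j * x i * x j) = M i a * x i * x a + M i b * x i * x b + M i c * x i * x c + M i d * x i * x d" for i
        by (rule S) (simp add: x0)
      hence "qform n M x = (\<Sum>i<n. M i a * x i * x a + M i b * x i * x b + M i c * x i * x c + M i d * x i * x d)"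
        by (simp add: qform_def)
      also have "\<dots> = (M a a * x a * x a + M a b * x a * x b + M a c * x a * x c + M a d * x a * x d) +
        (M b a * x b * x a + M b b * x b * x b + M b c * x b * x c + M b d * x b * x d) +
        (M c a * x c * x a + M c b * x c * x b + M c c * x c * x c + M c d * x c * x d) +
        (M d a * x d * x a + M d b * x d * x b + M d c * x d * x c + M d d * x d * x d)"
        by (rule S) (simp add: x0)
      also have "\<dots> = \<alpha> t + \<gamma> t - 2 * \<beta> t"
        using sym[of b a] sym[of c a] sym[of d a] sym[of c b] sym[of d b] sym[of d c] abcd
        unfolding xs \<alpha>_def \<beta>_def \<gamma>_def by (simp add: power2_eq_square algebra_simps)
      finally show ?thesis .
    qed
    finally show ?thesis by simp
  qed
  have off': "0 \<le> M a c" "0 \<le> M a d" "0 \<le> M b c" "0 \<le> M b d" "0 \<le> M a b" "0 \<le> M c d"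
    using off abcd by auto
  have \<beta>: "0 \<le> \<beta> t" if "0 \<le> t" "t \<le> 1" for t
    using y0[OF that] off' by (simp add: \<beta>_def)
  have "\<alpha> 0 \<le> 0" using diag[of b] abcd by (simp add: \<alpha>_def ya_def mult_le_0_iff)
  hence l0: "\<alpha> 0 - \<gamma> 0 \<le> 0" using gt[of 0] \<beta>[of 0] by simp
  have "\<gamma> 1 \<le> 0" using diag[of d] abcd by (simp add: \<gamma>_def yc_def mult_le_0_iff)
  hence l1: "0 \<le> \<alpha> 1 - \<gamma> 1" using gt[of 1] \<beta>[of 1] by simp
  have "continuous_on {0..1} (\<lambda>t. \<alpha> t - \<gamma> t)"
    unfolding \<alpha>_def \<gamma>_def y_def by (intro continuous_intros)
  then obtain t where t: "0 \<le> t" "t \<le> 1" "\<alpha> t - \<gamma> t = 0"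
    using IVT'[of "\<lambda>t. \<alpha> t - \<gamma> t" 0 0 1] l0 l1 by auto
  note D = diag[OF abcd(2)] diag[OF abcd(3)] diag[OF abcd(4)] diag[OF abcd(5)]
  note R = split_inequalities[of "- M a a" "- M b b" "- M c c" "- M d d" "M a c" "M a d" "M b c" "M b d"
     "M a b" "M c d" "ya t" "yb t" "yc t" "yd t"]
  have "\<beta> t < \<alpha> t" using t(3) gt[OF t(1,2)] by linarith
  have pre: "2 * M a b * ya t * yb t - - M a a * (ya t)\<^sup>2 - - M b b * (yb t)\<^sup>2
      = 2 * M c d * yc t * yd t - - M c c * (yc t)\<^sup>2 - - M d d * (yd t)\<^sup>2"
    "M a c * ya t * yc t + M a d * ya t * yd t + M b c * yb t * yc t + M b d * yb t * yd t
      < 2 * M a b * ya t * yb t - - M a a * (ya t)\<^sup>2 - - M b b * (yb t)\<^sup>2"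
    using t(3) \<open>\<beta> t < \<alpha> t\<close> unfolding \<alpha>_def \<beta>_def \<gamma>_def by simp_all
  show ?thesis
    unfolding split_pair_def using R[OF _ _ _ _ off' _ _ _ _ pre] D y0[OF t(1,2)] by simp
qed

lemma split_pair_commute:
  assumes "M a b = M b a" "M c d = M d c"
  shows "split_pair M b a c d = split_pair M a b c d" "split_pair M a b d c = split_pair M a b c d"
  using assms by (auto simp: split_pair_def mult.commute)

lemma separated_imp_split_pair:
  fixes M :: "nat \<Rightarrow> nat \<Rightarrow> real"
  assumes pos: "\<And>x. (\<exists>i<n. x i \<noteq> 0) \<Longrightarrow> (\<Sum>i<n. f i * x i) = 0 \<Longrightarrow> (\<Sum>i<n. g i * x i) = 0
      \<Longrightarrow> 0 < qform n M x"
    and sym: "\<And>i j. i < n \<Longrightarrow> j < n \<Longrightarrow> M i j = M j i"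
    and off: "\<And>i j. i < n \<Longrightarrow> j < n \<Longrightarrow> i \<noteq> j \<Longrightarrow> 0 \<le> M i j"
    and diag: "\<And>i. i < n \<Longrightarrow> M i i < 0"
    and nz: "\<And>i j. i < n \<Longrightarrow> j < n \<Longrightarrow> i \<noteq> j \<Longrightarrow> minor f g i j \<noteq> 0"
    and abcd: "distinct [a, b, c, d]" "a < n" "b < n" "c < n" "d < n"
    and sep: "separated (\<lambda>i j. 0 < minor f g i j) a b c d"
  shows "split_pair M a b c d"
proof -
  note C = crossing_imp_split_pair[OF pos sym off diag nz]
  have e: "M a b = M b a" "M c d = M d c" using sym abcd by auto
  have e': "M b a = M a b" "M d c = M c d" using e by auto
  from sep show ?thesis unfolding separated_def
  proof (elim disjE)
    assume "crossing (\<lambda>i j. 0 < minor f g i j) a b c d"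
    thus ?thesis using abcd by (intro C) auto
  next
    assume "crossing (\<lambda>i j. 0 < minor f g i j) b a c d"
    hence "split_pair M b a c d" using abcd by (intro C) auto
    thus ?thesis using split_pair_commute(1)[of M a b c d] e by simp
  next
    assume "crossing (\<lambda>i j. 0 < minor f g i j) a b d c"
    hence "split_pair M a b d c" using abcd by (intro C) auto
    thus ?thesis using split_pair_commute(2)[of M a b c d] e by simp
  next
    assume "crossing (\<lambda>i j. 0 < minor f g i j) b a d c"
    hence "split_pair M b a d c" using abcd by (intro C) auto
    thus ?thesis using split_pair_commute(1)[of M a b d c] split_pair_commute(2)[of M a b c d] e by simp
  qed
qed

section \<open>Arranging the indices in a cycle\<close>

text \<open>
  The 32 sign patterns realize each of the 12 cyclic arrangements of five indices; the list was found by
  enumeration.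
\<close>
lemma five_cycle_of_sign_pattern:
  fixes s0 s1 s2 s3 s4 :: bool
  assumes "S i0 i1 = (s0 = s1)" "S i0 i2 = (s0 = s2)" "S i0 i3 = (s0 = s3)" "S i0 i4 = (s0 = s4)"
    "S i1 i2 = (s1 = s2)" "S i1 i3 = (s1 = s3)" "S i1 i4 = (s1 = s4)"
    "S i2 i3 = (s2 = s3)" "S i2 i4 = (s2 = s4)" "S i3 i4 = (s3 = s4)"
    "S i1 i0 = (s0 \<noteq> s1)" "S i2 i0 = (s0 \<noteq> s2)" "S i3 i0 = (s0 \<noteq> s3)" "S i4 i0 = (s0 \<noteq> s4)"
    "S i2 i1 = (s1 \<noteq> s2)" "S i3 i1 = (s1 \<noteq> s3)" "S i4 i1 = (s1 \<noteq> s4)"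
    "S i3 i2 = (s2 \<noteq> s3)" "S i4 i2 = (s2 \<noteq> s4)" "S i4 i3 = (s3 \<noteq> s4)"
  shows "\<exists>(a, b, c, d, e) \<in> {(i0, i2, i4, i1, i3), (i0, i2, i3, i1, i4), (i0, i3, i2, i1, i4),
      (i0, i2, i1, i4, i3), (i0, i2, i1, i3, i4), (i0, i3, i1, i2, i4), (i0, i1, i2, i4, i3),
      (i0, i1, i2, i3, i4), (i0, i1, i4, i2, i3), (i0, i1, i3, i2, i4), (i0, i1, i4, i3, i2),
      (i0, i1, i3, i4, i2)}.
    separated S a b c d \<and> separated S b c d e \<and> separated S e a b c"
  by (cases s0; cases s1; cases s2; cases s3; cases s4; simp add: separated_def crossing_def assms)

text \<open>As no \<open>f i\<close> vanishes,
  \<open>minor f g j k = f j * f k * (\<rho> k - \<rho> j)\<close> with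
  \<open>\<rho> = g / f\<close>. Once the indices are sorted by \<open>\<rho>\<close>, the signs of
  the minors depend only on the signs of \<open>f\<close>, which leaves the patterns enumerated
  above.\<close>

lemma five_cycle_exists:
  fixes f g :: "nat \<Rightarrow> real"
  assumes f: "\<And>i. i < 5 \<Longrightarrow> f i \<noteq> 0"
    and nz: "\<And>i j. i < 5 \<Longrightarrow> j < 5 \<Longrightarrow> i \<noteq> j \<Longrightarrow> minor f g i j \<noteq> 0"
  shows "\<exists>a b c d e. distinct [a, b, c, d, e] \<and> set [a, b, c, d, e] = {..<5} \<and>
    separated (\<lambda>i j. 0 < minor f g i j) a b c d \<and> separated (\<lambda>i j. 0 < minor f g i j) b c d e \<and>
    separated (\<lambda>i j. 0 < minor f g i j) e a b c"
proof -
  define \<rho> where "\<rho> i = g i / f i" for i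
  define xs where "xs = sort_key \<rho> [0..<5]"
  have xs: "distinct xs" "set xs = {..<5}" "length xs = 5" "sorted (map \<rho> xs)"
    by (auto simp: xs_def)
  obtain i0 i1 i2 i3 i4 where i: "xs = [i0, i1, i2, i3, i4]"
    using xs(3) by (auto simp: length_Suc_conv eval_nat_numeral)
  have lt: "i0 < 5" "i1 < 5" "i2 < 5" "i3 < 5" "i4 < 5" using xs(2) unfolding i by auto
  have minor: "minor f g j k = f j * f k * (\<rho> k - \<rho> j)" if "j < 5" "k < 5" for j k
    using f[OF that(1)] f[OF that(2)] by (simp add: minor_def \<rho>_def field_simps)
  have S: "0 < minor f g j k \<longleftrightarrow> (0 < f j) = (0 < f k)" "0 < minor f g k j \<longleftrightarrow> (0 < f j) \<noteq> (0 < f k)"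
    if "j < 5" "k < 5" "j \<noteq> k" "\<rho> j \<le> \<rho> k" for j k
  proof -
    have "\<rho> j < \<rho> k" using nz[OF that(1-3)] minor[OF that(1,2)] that(4) by (cases "\<rho> j = \<rho> k") auto
    thus "0 < minor f g j k \<longleftrightarrow> (0 < f j) = (0 < f k)" "0 < minor f g k j \<longleftrightarrow> (0 < f j) \<noteq> (0 < f k)"
      using f[OF that(1)] f[OF that(2)] that(1,2)
      by (auto simp: minor zero_less_mult_iff mult_less_0_iff not_less)
  qed
  have sorted: "\<rho> i0 \<le> \<rho> i1" "\<rho> i0 \<le> \<rho> i2" "\<rho> i0 \<le> \<rho> i3" "\<rho> i0 \<le> \<rho> i4" "\<rho> i1 \<le> \<rho> i2" "\<rho> i1 \<le> \<rho> i3"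
    "\<rho> i1 \<le> \<rho> i4" "\<rho> i2 \<le> \<rho> i3" "\<rho> i2 \<le> \<rho> i4" "\<rho> i3 \<le> \<rho> i4"
    using xs(4) unfolding i by auto
  have neq: "i0 \<noteq> i1" "i0 \<noteq> i2" "i0 \<noteq> i3" "i0 \<noteq> i4" "i1 \<noteq> i2" "i1 \<noteq> i3" "i1 \<noteq> i4" "i2 \<noteq> i3" "i2 \<noteq> i4" "i3 \<noteq> i4"
    using xs(1) unfolding i by auto
  define L where "L = {(i0, i2, i4, i1, i3), (i0, i2, i3, i1, i4), (i0, i3, i2, i1, i4),
      (i0, i2, i1, i4, i3), (i0, i2, i1, i3, i4), (i0, i3, i1, i2, i4), (i0, i1, i2, i4, i3),
      (i0, i1, i2, i3, i4), (i0, i1, i4, i2, i3), (i0, i1, i3, i2, i4), (i0, i1, i4, i3, i2),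
      (i0, i1, i3, i4, i2)}"
  have "\<exists>(a, b, c, d, e) \<in> L. separated (\<lambda>i j. 0 < minor f g i j) a b c d \<and>
    separated (\<lambda>i j. 0 < minor f g i j) b c d e \<and> separated (\<lambda>i j. 0 < minor f g i j) e a b c"
    unfolding L_def
    by (rule five_cycle_of_sign_pattern[where ?s0.0 = "0 < f i0" and ?s1.0 = "0 < f i1" and ?s2.0 = "0 < f i2"
        and ?s3.0 = "0 < f i3" and ?s4.0 = "0 < f i4"]) (rule S, fact, fact, fact, fact)+
  then obtain z where z: "z \<in> L" "case z of (a, b, c, d, e) \<Rightarrow>
    separated (\<lambda>i j. 0 < minor f g i j) a b c d \<and> separated (\<lambda>i j. 0 < minor f g i j) b c d e \<and>
    separated (\<lambda>i j. 0 < minor f g i j) e a b c" by blast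
  obtain a b c d e where "z = (a, b, c, d, e)" by (cases z)
  with z have abcde: "(a, b, c, d, e) \<in> L"
    "separated (\<lambda>i j. 0 < minor f g i j) a b c d" "separated (\<lambda>i j. 0 < minor f g i j) b c d e"
    "separated (\<lambda>i j. 0 < minor f g i j) e a b c" by auto
  have "mset [a, b, c, d, e] = mset xs" using abcde(1) unfolding i L_def by auto
  hence "distinct [a, b, c, d, e]" "set [a, b, c, d, e] = {..<5}"
    using xs(1,2) mset_eq_setD mset_eq_imp_distinct_iff by metis+
  with abcde show ?thesis by blast
qed


text \<open>Three paths of four vertices on the cycle supply the inequalities for all five edges
  that \<open>pentagon_top_eigenvalue\<close> requires. The entries at the five chords are
  nonnegative, so for nonnegative vectors they may be dropped from the upper bound.\<close>

lemma top_eigenvalue_bound: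
  fixes M :: "nat \<Rightarrow> nat \<Rightarrow> real"
  assumes pos: "\<And>x. (\<exists>i<5. x i \<noteq> 0) \<Longrightarrow> (\<Sum>i<5. f i * x i) = 0 \<Longrightarrow> (\<Sum>i<5. g i * x i) = 0
      \<Longrightarrow> 0 < qform 5 M x"
    and f: "\<And>i. i < 5 \<Longrightarrow> f i \<noteq> 0"
    and nz: "\<And>i j. i < 5 \<Longrightarrow> j < 5 \<Longrightarrow> i \<noteq> j \<Longrightarrow> minor f g i j \<noteq> 0"
    and sym: "\<And>i j. i < 5 \<Longrightarrow> j < 5 \<Longrightarrow> M i j = M j i"
    and off: "\<And>i j. i < 5 \<Longrightarrow> j < 5 \<Longrightarrow> i \<noteq> j \<Longrightarrow> 0 \<le> M i j"
    and diag: "\<And>i. i < 5 \<Longrightarrow> M i i < 0" "\<And>i. i < 5 \<Longrightarrow> - M i i \<le> T"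
    and tr: "4 * T \<le> (\<Sum>i<5. - M i i)"
    and upper: "\<And>x. qform 5 M x \<le> \<tau> * (\<Sum>i<5. (x i)\<^sup>2)"
  shows "T \<le> \<tau>"
proof -
  obtain a b c d e where dist: "distinct [a, b, c, d, e]" and all: "set [a, b, c, d, e] = {..<5}"
    and sep: "separated (\<lambda>i j. 0 < minor f g i j) a b c d" "separated (\<lambda>i j. 0 < minor f g i j) b c d e"
      "separated (\<lambda>i j. 0 < minor f g i j) e a b c"
    using five_cycle_exists[OF f nz] by blast
  have lt: "a < 5" "b < 5" "c < 5" "d < 5" "e < 5" using all by auto
  note SP = separated_imp_split_pair[OF pos sym off diag(1) nz]
  have abcd: "split_pair M a b c d" by (rule SP) (use dist lt sep in auto)
  have bcde: "split_pair M b c d e" by (rule SP) (use dist lt sep in auto)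
  have eabc: "split_pair M e a b c" by (rule SP) (use dist lt sep in auto)
  have sum5: "(\<Sum>i<5. F i) = F a + F b + F c + F d + F e" for F :: "nat \<Rightarrow> real"
    unfolding all[symmetric] using dist by (simp add: ac_simps)
  have heavy: "M a a * M b b < (M a b)\<^sup>2" "M b b * M c c < (M b c)\<^sup>2" "M c c * M d d < (M c d)\<^sup>2"
    "M d d * M e e < (M d e)\<^sup>2" "M e e * M a a < (M e a)\<^sup>2"
    using abcd bcde eabc by (auto simp: split_pair_def)
  have paths: "M a a * M d d * (M b c)\<^sup>2 < ((M a b)\<^sup>2 - M a a * M b b) * ((M c d)\<^sup>2 - M c c * M d d)"
    "M b b * M e e * (M c d)\<^sup>2 < ((M b c)\<^sup>2 - M b b * M c c) * ((M d e)\<^sup>2 - M d d * M e e)"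
    "M e e * M c c * (M a b)\<^sup>2 < ((M e a)\<^sup>2 - M e e * M a a) * ((M b c)\<^sup>2 - M b b * M c c)"
    using abcd bcde eabc by (auto simp: split_pair_def)
  have bound: "2 * (M a b * x1 * x2 + M b c * x2 * x3 + M c d * x3 * x4 + M d e * x4 * x5 + M e a * x5 * x1)
      - (- M a a * x1\<^sup>2 + - M b b * x2\<^sup>2 + - M c c * x3\<^sup>2 + - M d d * x4\<^sup>2 + - M e e * x5\<^sup>2)
      \<le> \<tau> * (x1\<^sup>2 + x2\<^sup>2 + x3\<^sup>2 + x4\<^sup>2 + x5\<^sup>2)"
    if x: "0 \<le> x1" "0 \<le> x2" "0 \<le> x3" "0 \<le> x4" "0 \<le> x5" for x1 x2 x3 x4 x5
  proof -
    define x where "x i = (if i = a then x1 else if i = b then x2 else if i = c then x3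
      else if i = d then x4 else x5)" for i
    have xs: "x a = x1" "x b = x2" "x c = x3" "x d = x4" "x e = x5" using dist by (auto simp: x_def)
    have chords: "0 \<le> M a c * x1 * x3" "0 \<le> M a d * x1 * x4" "0 \<le> M b d * x2 * x4" "0 \<le> M b e * x2 * x5"
      "0 \<le> M c e * x3 * x5"
      using x off lt dist by auto
    have "qform 5 M x = 2 * (M a b * x1 * x2 + M b c * x2 * x3 + M c d * x3 * x4 + M d e * x4 * x5 + M e a * x5 * x1)
      - (- M a a * x1\<^sup>2 + - M b b * x2\<^sup>2 + - M c c * x3\<^sup>2 + - M d d * x4\<^sup>2 + - M e e * x5\<^sup>2)
      + 2 * (M a c * x1 * x3 + M a d * x1 * x4 + M b d * x2 * x4 + M b e * x2 * x5 + M c e * x3 * x5)"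
      using sym[of b a] sym[of c a] sym[of d a] sym[of a e] sym[of c b] sym[of d b] sym[of e b]
        sym[of d c] sym[of e c] sym[of e d] lt
      unfolding qform_def sum5 xs by (simp add: power2_eq_square algebra_simps)
    note eq = this
    have le: "qform 5 M x \<le> \<tau> * (x1\<^sup>2 + x2\<^sup>2 + x3\<^sup>2 + x4\<^sup>2 + x5\<^sup>2)"
      using upper[of x] unfolding sum5 xs .
    have "A \<le> r" if "0 \<le> c1" "0 \<le> c2" "0 \<le> c3" "0 \<le> c4" "0 \<le> c5" "q \<le> r"
      "q = A + 2 * (c1 + c2 + c3 + c4 + c5)" for A q r c1 c2 c3 c4 c5 :: real
      using that by argo
    from this[OF chords le eq] show ?thesis .
  qed
  have off': "0 \<le> M a b" "0 \<le> M b c" "0 \<le> M c d" "0 \<le> M d e" "0 \<le> M e a"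
    using off lt dist by auto
  have "4 * T \<le> - M a a + - M b b + - M c c + - M d d + - M e e" using tr unfolding sum5 .
  note P = pentagon_top_eigenvalue[OF _ _ _ _ _ _ _ _ _ _ this off' _ _ _ _ _ _ _ _ bound]
  show ?thesis by (rule P) (use diag lt heavy paths in simp_all)
qed

section \<open>Necessary conditions\<close>

text \<open>The \<open>e k\<close> are the columns of the diagonalizing matrix \<open>U\<close>.
  Orthonormality of its columns gives the first property, orthonormality of its rows gives
  Parseval's identity.\<close>

lemma spectral_decomposition:
  assumes A: "A \<in> carrier_mat n n" and sym: "symmetric_mat A" and spec: "is_spectrum_of \<sigma> A"
  shows "\<exists>e :: nat \<Rightarrow> nat \<Rightarrow> real. (\<forall>k<n. \<forall>l<n. (\<Sum>i<n. e k i * e l i) = (if k = l then 1 else 0)) \<and>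
      (\<forall>k<n. \<forall>i<n. (\<Sum>j<n. A $$ (i, j) * e k j) = \<sigma> ! k * e k i) \<and>
      (\<forall>x. (\<Sum>i<n. (x i)\<^sup>2) = (\<Sum>k<n. (\<Sum>i<n. e k i * x i)\<^sup>2)) \<and>
      (\<forall>x. qform n (\<lambda>i j. A $$ (i, j)) x = (\<Sum>k<n. \<sigma> ! k * (\<Sum>i<n. e k i * x i)\<^sup>2)) \<and>
      (\<Sum>i<n. A $$ (i, i)) = sum_list \<sigma>"
proof -
  have "A\<^sup>T = A" using sym by (simp add: symmetric_mat_def)
  moreover have "char_poly A = (\<Prod>e\<leftarrow>\<sigma>. [:- e, 1:])"
    using spec char_poly_of_is_spectrum_of[OF A] by simp
  ultimately obtain U where len: "length \<sigma> = n" and U: "U \<in> carrier_mat n n" "U\<^sup>T * U = 1\<^sub>m n"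
    "U\<^sup>T * A * U = mat n n (\<lambda>(i, j). if i = j then \<sigma> ! i else 0)"
    using symmetric_orthogonal_diagonalization[OF A] by blast
  define D where "D = mat n n (\<lambda>(i, j). if i = j then \<sigma> ! i else 0)"
  have D: "D \<in> carrier_mat n n" by (simp add: D_def)
  have UT: "U\<^sup>T \<in> carrier_mat n n" using U by simp
  have UU: "U * U\<^sup>T = 1\<^sub>m n" using mat_mult_left_right_inverse[OF UT U(1,2)] .
  have "A = (U * U\<^sup>T) * A * (U * U\<^sup>T)" using A UU by simp
  also have "\<dots> = U * (U\<^sup>T * A * U) * U\<^sup>T" using A U(1) UT
    by (simp add: assoc_mult_mat[of _ n n _ n _ n])
  finally have AUDU: "A = U * D * U\<^sup>T" unfolding U(3) D_def .
  define e where "e k i = U $$ (i, k)" for k i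
  have on: "(\<Sum>i<n. e k i * e l i) = (if k = l then 1 else 0)" if "k < n" "l < n" for k l
  proof -
    have "(\<Sum>i<n. e k i * e l i) = (U\<^sup>T * U) $$ (k, l)"
      using U(1) that by (simp add: scalar_prod_def atLeast0LessThan e_def)
    thus ?thesis using that by (simp add: U(2))
  qed
  have on': "(\<Sum>k<n. e k i * e k j) = (if i = j then 1 else 0)" if "i < n" "j < n" for i j
  proof -
    have "(\<Sum>k<n. e k i * e k j) = (U * U\<^sup>T) $$ (i, j)"
      using U(1) that by (simp add: scalar_prod_def atLeast0LessThan e_def)
    thus ?thesis using that by (simp add: UU)
  qed
  have UD: "(U * D) $$ (i, k) = e k i * \<sigma> ! k" if "i < n" "k < n" for i k
  proof -
    have "(U * D) $$ (i, k) = (\<Sum>l<n. U $$ (i, l) * (if l = k then \<sigma> ! l else 0))"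
      using U(1) that by (simp add: scalar_prod_def atLeast0LessThan D_def)
    also have "\<dots> = (\<Sum>l<n. if l = k then U $$ (i, l) * \<sigma> ! l else 0)" by (rule sum.cong) auto
    finally show ?thesis using that by (simp add: e_def)
  qed
  have rep: "A $$ (i, j) = (\<Sum>k<n. \<sigma> ! k * (e k i * e k j))" if "i < n" "j < n" for i j
  proof -
    have "(V * U\<^sup>T) $$ (i, j) = (\<Sum>k<n. V $$ (i, k) * U $$ (j, k))" if "V \<in> carrier_mat n n" for V
      using that U(1) \<open>i < n\<close> \<open>j < n\<close> by (simp add: scalar_prod_def atLeast0LessThan)
    from this[of "U * D"] have "A $$ (i, j) = (\<Sum>k<n. (U * D) $$ (i, k) * U $$ (j, k))"
      unfolding AUDU[symmetric] using U(1) D by simp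
    also have "\<dots> = (\<Sum>k<n. \<sigma> ! k * (e k i * e k j))"
      by (rule sum.cong) (use UD that in \<open>auto simp: e_def\<close>)
    finally show ?thesis .
  qed
  show ?thesis
  proof (intro exI[of _ e] conjI allI impI)
    fix k i assume ki: "k < n" "i < n"
    have "(\<Sum>j<n. A $$ (i, j) * e k j) = (\<Sum>j<n. \<Sum>l<n. \<sigma> ! l * e l i * (e l j * e k j))"
      using ki by (intro sum.cong) (auto simp: rep sum_distrib_left mult_ac)
    also have "\<dots> = (\<Sum>l<n. \<sigma> ! l * e l i * (\<Sum>j<n. e l j * e k j))"
      by (subst sum.swap) (simp add: sum_distrib_left)
    also have "\<dots> = (\<Sum>l<n. if l = k then \<sigma> ! l * e l i else 0)"
      using ki by (intro sum.cong) (auto simp: on)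
    finally show "(\<Sum>j<n. A $$ (i, j) * e k j) = \<sigma> ! k * e k i" using ki by simp
  next
    fix x :: "nat \<Rightarrow> real"
    have sq: "(\<Sum>i<n. e k i * x i)\<^sup>2 = (\<Sum>i<n. \<Sum>j<n. e k i * e k j * x i * x j)" for k
      by (simp add: power2_eq_square sum_product mult_ac)
    have "(\<Sum>k<n. (\<Sum>i<n. e k i * x i)\<^sup>2) = (\<Sum>i<n. \<Sum>k<n. \<Sum>j<n. e k i * e k j * x i * x j)"
      unfolding sq by (rule sum.swap)
    also have "\<dots> = (\<Sum>i<n. \<Sum>j<n. \<Sum>k<n. e k i * e k j * x i * x j)"
      by (rule sum.cong[OF refl]) (rule sum.swap)
    also have "\<dots> = (\<Sum>i<n. \<Sum>j<n. if i = j then x i * x j else 0)"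
      by (intro sum.cong) (auto simp: on' simp flip: sum_distrib_right)
    finally show "(\<Sum>i<n. (x i)\<^sup>2) = (\<Sum>k<n. (\<Sum>i<n. e k i * x i)\<^sup>2)"
      by (simp add: power2_eq_square)
    have "(\<Sum>k<n. \<sigma> ! k * (\<Sum>i<n. e k i * x i)\<^sup>2) =
      (\<Sum>i<n. \<Sum>k<n. \<Sum>j<n. \<sigma> ! k * (e k i * e k j) * x i * x j)"
      unfolding sq by (subst sum.swap) (simp add: sum_distrib_left mult_ac)
    also have "\<dots> = (\<Sum>i<n. \<Sum>j<n. \<Sum>k<n. \<sigma> ! k * (e k i * e k j) * x i * x j)"
      by (rule sum.cong[OF refl]) (rule sum.swap)
    also have "\<dots> = qform n (\<lambda>i j. A $$ (i, j)) x"
      unfolding qform_def by (intro sum.cong) (auto simp: rep simp flip: sum_distrib_right)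
    finally show "qform n (\<lambda>i j. A $$ (i, j)) x = (\<Sum>k<n. \<sigma> ! k * (\<Sum>i<n. e k i * x i)\<^sup>2)" ..
  next
    have "(\<Sum>i<n. A $$ (i, i)) = (\<Sum>i<n. \<Sum>k<n. \<sigma> ! k * (e k i * e k i))"
      by (rule sum.cong) (auto simp: rep)
    also have "\<dots> = (\<Sum>k<n. \<sigma> ! k * (\<Sum>i<n. e k i * e k i))"
      by (subst sum.swap) (simp add: sum_distrib_left)
    also have "\<dots> = (\<Sum>k<n. \<sigma> ! k)" by (rule sum.cong) (auto simp: on)
    finally show "(\<Sum>i<n. A $$ (i, i)) = sum_list \<sigma>" by (simp add: sum_list_sum_nth len atLeast0LessThan)
  qed (use len on in auto)
qed

section \<open>Conditions (1) and (2): absolute values and positive parts of eigenvectors\<close>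

lemma qform_abs_bound:
  assumes "\<And>i j. i < n \<Longrightarrow> j < n \<Longrightarrow> 0 \<le> a i j"
  shows "- qform n a (\<lambda>i. \<bar>x i\<bar>) \<le> qform n a x"
proof -
  have "- qform n a (\<lambda>i. \<bar>x i\<bar>) = (\<Sum>i<n. \<Sum>j<n. - (a i j * \<bar>x i\<bar> * \<bar>x j\<bar>))"
    by (simp add: qform_def sum_negf)
  also have "\<dots> \<le> qform n a x" unfolding qform_def
  proof (intro sum_mono)
    fix i j assume "i \<in> {..<n}" "j \<in> {..<n}"
    hence "\<bar>a i j * x i * x j\<bar> = a i j * \<bar>x i\<bar> * \<bar>x j\<bar>" using assms by (simp add: abs_mult)
    thus "- (a i j * \<bar>x i\<bar> * \<bar>x j\<bar>) \<le> a i j * x i * x j" by (metis abs_ge_minus_self minus_le_iff)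
  qed
  finally show ?thesis .
qed

text \<open>Let \<open>v\<close> be the positive part of \<open>y\<close>. Then
  \<open>v i * y i = (v i)^2\<close>, while replacing \<open>y\<close> by \<open>v\<close> in row
  \<open>i\<close> of the product with \<open>a\<close> can only raise it.\<close>

lemma positive_part_rayleigh:
  assumes a: "\<And>i j. i < n \<Longrightarrow> j < n \<Longrightarrow> 0 \<le> a i j"
    and ev: "\<And>i. i < n \<Longrightarrow> (\<Sum>j<n. a i j * y j) = \<mu> * y i"
  shows "\<mu> * (\<Sum>i<n. (max (y i) 0)\<^sup>2) \<le> qform n a (\<lambda>i. max (y i) 0)"
proof -
  define v where "v i = max (y i) 0" for i
  have "\<mu> * (v i)\<^sup>2 \<le> (\<Sum>j<n. a i j * v i * v j)" if "i < n" for i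
  proof -
    have "\<mu> * (v i)\<^sup>2 = v i * (\<mu> * y i)" by (auto simp: v_def max_def power2_eq_square)
    also have "\<dots> = v i * (\<Sum>j<n. a i j * y j)" using ev[OF that] by simp
    also have "\<dots> \<le> v i * (\<Sum>j<n. a i j * v j)"
      using a that by (intro mult_left_mono sum_mono) (auto simp: v_def)
    finally show ?thesis by (simp add: sum_distrib_left mult_ac)
  qed
  hence "(\<Sum>i<n. \<mu> * (v i)\<^sup>2) \<le> qform n a v" unfolding qform_def by (intro sum_mono) auto
  hence "\<mu> * (\<Sum>i<n. (v i)\<^sup>2) \<le> qform n a v" by (simp add: sum_distrib_left)
  moreover have "v = (\<lambda>i. max (y i) 0)" by (simp add: v_def fun_eq_iff)
  ultimately show ?thesis by simp
qed

lemma subset_doubleton: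
  assumes "S \<subseteq> {..<n}" "card S \<le> 2" "2 \<le> n"
  obtains p q :: nat where "p < n" "q < n" "p \<noteq> q" "S \<subseteq> {p, q}"
proof -
  have "\<exists>R. S \<subseteq> R \<and> R \<subseteq> {..<n} \<and> card R = 2"
    using exists_subset_between[of S 2 "{..<n}"] assms by auto
  then obtain R where "S \<subseteq> R" "R \<subseteq> {..<n}" "card R = 2" by blast
  moreover then obtain p q where "R = {p, q}" "p \<noteq> q" by (auto simp: card_2_iff)
  ultimately show ?thesis using that[of p q] by auto
qed

text \<open>Let \<open>w\<close> be \<open>v\<close> turned by a right angle in the coordinate plane
  of \<open>p\<close> and \<open>q\<close>. The values of the form at \<open>v\<close> and
  \<open>w\<close> add up to \<open>a p p + a q q\<close> times the squared length;
  \<open>upper\<close> bounds the first and \<open>lower\<close> the second from below.\<close>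

lemma rayleigh_pair:
  fixes a :: "nat \<Rightarrow> nat \<Rightarrow> real"
  assumes pq: "p < n" "q < n" "p \<noteq> q" and supp: "\<And>i. i \<notin> {p, q} \<Longrightarrow> v i = 0"
    and nz: "\<exists>i. v i \<noteq> 0" and sym: "a q p = a p q"
    and upper: "\<mu> * (\<Sum>i<n. (v i)\<^sup>2) \<le> qform n a v"
    and lower: "\<And>x. \<nu> * (\<Sum>i<n. (x i)\<^sup>2) \<le> qform n a x"
  shows "\<mu> + \<nu> \<le> a p p + a q q"
proof -
  have sum2: "(\<Sum>i<n. F i) = F p + F q" if "\<And>i. i \<notin> {p, q} \<Longrightarrow> F i = 0" for F :: "nat \<Rightarrow> real"
  proof -
    have "(\<Sum>i<n. F i) = (\<Sum>i\<in>{p, q}. F i)"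
      by (rule sum.mono_neutral_right) (use pq that in auto)
    thus ?thesis using pq by simp
  qed
  have Q: "qform n a x = a p p * (x p)\<^sup>2 + a q q * (x q)\<^sup>2 + 2 * a p q * x p * x q"
    and N: "(\<Sum>i<n. (x i)\<^sup>2) = (x p)\<^sup>2 + (x q)\<^sup>2" if x: "\<And>i. i \<notin> {p, q} \<Longrightarrow> x i = 0" for x
  proof -
    have "(\<Sum>j<n. a i j * x i * x j) = a i p * x i * x p + a i q * x i * x q" for i
      by (rule sum2) (simp add: x)
    hence "qform n a x = (\<Sum>i<n. a i p * x i * x p + a i q * x i * x q)" by (simp add: qform_def)
    also have "\<dots> = (a p p * x p * x p + a p q * x p * x q) + (a q p * x q * x p + a q q * x q * x q)"
      by (rule sum2) (simp add: x)
    finally show "qform n a x = a p p * (x p)\<^sup>2 + a q q * (x q)\<^sup>2 + 2 * a p q * x p * x q"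
      by (simp add: sym power2_eq_square algebra_simps)
    show "(\<Sum>i<n. (x i)\<^sup>2) = (x p)\<^sup>2 + (x q)\<^sup>2" by (rule sum2) (simp add: x)
  qed
  define w where "w i = (if i = p then - v q else if i = q then v p else 0)" for i
  have ws: "w p = - v q" "w q = v p" using pq by (auto simp: w_def)
  have w0: "w i = 0" if "i \<notin> {p, q}" for i using that by (auto simp: w_def)
  have "\<mu> * ((v p)\<^sup>2 + (v q)\<^sup>2) + \<nu> * ((v p)\<^sup>2 + (v q)\<^sup>2) \<le> (a p p + a q q) * ((v p)\<^sup>2 + (v q)\<^sup>2)"
  proof -
    have "qform n a v = a p p * (v p)\<^sup>2 + a q q * (v q)\<^sup>2 + 2 * a p q * v p * v q"
      "(\<Sum>i<n. (v i)\<^sup>2) = (v p)\<^sup>2 + (v q)\<^sup>2"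
      using Q N supp by blast+
    moreover have "qform n a w = a p p * (v q)\<^sup>2 + a q q * (v p)\<^sup>2 - 2 * a p q * v p * v q"
      "(\<Sum>i<n. (w i)\<^sup>2) = (v p)\<^sup>2 + (v q)\<^sup>2"
      using Q[of w] N[of w] w0 by (simp_all add: ws)
    ultimately show ?thesis using upper lower[of w] by (simp add: algebra_simps)
  qed
  hence "(\<mu> + \<nu>) * ((v p)\<^sup>2 + (v q)\<^sup>2) \<le> (a p p + a q q) * ((v p)\<^sup>2 + (v q)\<^sup>2)"
    by (simp add: distrib_right)
  moreover have "0 < (v p)\<^sup>2 + (v q)\<^sup>2"
    using nz supp by (metis insert_iff singletonD sum_power2_gt_zero_iff)
  ultimately show ?thesis by (simp add: mult_le_cancel_right)
qed

lemma second_plus_last_le_trace: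
  fixes a e :: "nat \<Rightarrow> nat \<Rightarrow> real"
  assumes a: "\<And>i j. i < 5 \<Longrightarrow> j < 5 \<Longrightarrow> 0 \<le> a i j"
    and sym: "\<And>i j. i < 5 \<Longrightarrow> j < 5 \<Longrightarrow> a i j = a j i"
    and on: "(\<Sum>i<5. e 0 i * e 1 i) = 0" "\<And>k. k < 2 \<Longrightarrow> \<exists>i<5. e k i \<noteq> 0"
    and ev: "\<And>k i. k < 2 \<Longrightarrow> i < 5 \<Longrightarrow> (\<Sum>j<5. a i j * e k j) = \<mu> k * e k i"
    and le: "\<mu> 1 \<le> \<mu> 0"
    and lower: "\<And>x. \<nu> * (\<Sum>i<5. (x i)\<^sup>2) \<le> qform 5 a x"
  shows "\<mu> 1 + \<nu> \<le> (\<Sum>i<5. a i i)"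
proof -
  \<comment> \<open>Good sets are the nonempty supports of nonnegative vectors with Rayleigh
    quotient at least \<open>\<mu> 1\<close>.\<close>
  define good where "good S \<longleftrightarrow> S \<noteq> {} \<and> (\<exists>v. S = {i. i < 5 \<and> 0 < v i} \<and> (\<forall>i<5. 0 \<le> v i) \<and>
    \<mu> 1 * (\<Sum>i<5. (v i)\<^sup>2) \<le> qform 5 a v)" for S :: "nat set"
  have part: "good {i. i < 5 \<and> 0 < s * e k i}"
    if k: "k < 2" and s: "s \<noteq> 0" and ne: "{i. i < 5 \<and> 0 < s * e k i} \<noteq> {}" for k s
  proof -
    have ev': "(\<Sum>j<5. a i j * (s * e k j)) = \<mu> k * (s * e k i)" if "i < 5" for i
      using ev[OF k that] by (simp add: sum_distrib_left mult_ac flip: sum_distrib_left)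
    have "\<mu> 1 * (\<Sum>i<5. (max (s * e k i) 0)\<^sup>2) \<le> \<mu> k * (\<Sum>i<5. (max (s * e k i) 0)\<^sup>2)"
      using le k by (intro mult_right_mono sum_nonneg) (auto simp: less_2_cases_iff)
    also have "\<dots> \<le> qform 5 a (\<lambda>i. max (s * e k i) 0)" by (rule positive_part_rayleigh[OF a ev'])
    finally show ?thesis unfolding good_def using ne
      by (intro conjI exI[of _ "\<lambda>i. max (s * e k i) 0"]) auto
  qed
  \<comment> \<open>Either one of the two eigenvectors has both signs, and its positive and negative
    parts have disjoint supports, or both have constant sign, and their orthogonality forces
    disjoint supports.\<close>
  have "\<exists>S R. good S \<and> good R \<and> S \<inter> R = {}"
  proof (cases "\<exists>k<2. {i. i < 5 \<and> 0 < 1 * e k i} \<noteq> {} \<and> {i. i < 5 \<and> 0 < (- 1) * e k i} \<noteq> {}")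
    case True
    then obtain k where k: "k < 2" "{i. i < 5 \<and> 0 < 1 * e k i} \<noteq> {}" "{i. i < 5 \<and> 0 < (- 1) * e k i} \<noteq> {}" by blast
    have "{i. i < 5 \<and> 0 < 1 * e k i} \<inter> {i. i < 5 \<and> 0 < (- 1) * e k i} = {}" by auto
    moreover have "good {i. i < 5 \<and> 0 < 1 * e k i}" by (rule part[OF k(1) _ k(2)]) simp
    moreover have "good {i. i < 5 \<and> 0 < (- 1) * e k i}" by (rule part[OF k(1) _ k(3)]) simp
    ultimately show ?thesis by blast
  next
    case False
    have "\<exists>s. s \<noteq> 0 \<and> {i. i < 5 \<and> 0 < s * e k i} \<noteq> {} \<and> (\<forall>i<5. 0 \<le> s * e k i)" if k: "k < 2" for k
    proof (cases "{i. i < 5 \<and> 0 < 1 * e k i} \<noteq> {}")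
      case True
      hence "\<forall>i<5. 0 \<le> e k i" using False k by (fastforce simp: not_less)
      with True show ?thesis by (intro exI[of _ 1]) auto
    next
      case f: False
      obtain i where i: "i < 5" "e k i \<noteq> 0" using on(2)[OF k] by blast
      have le: "\<forall>i<5. e k i \<le> 0" using f by force
      hence "e k i \<le> 0" using i(1) by blast
      hence "0 < - 1 * e k i" using i(2) by simp
      with i le show ?thesis by (intro exI[of _ "- 1"]) auto
    qed
    from this[of 0] this[of 1] obtain s t where
      s: "s \<noteq> 0" "{i. i < 5 \<and> 0 < s * e 0 i} \<noteq> {}" "\<forall>i<5. 0 \<le> s * e 0 i" and
      t: "t \<noteq> 0" "{i. i < 5 \<and> 0 < t * e 1 i} \<noteq> {}" "\<forall>i<5. 0 \<le> t * e 1 i" by auto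
    have "(\<Sum>i<5. (s * e 0 i) * (t * e 1 i)) = s * t * (\<Sum>i<5. e 0 i * e 1 i)"
      by (simp add: sum_distrib_left mult_ac)
    hence "(\<Sum>i<5. (s * e 0 i) * (t * e 1 i)) = 0" using on(1) by simp
    hence "\<forall>i<5. (s * e 0 i) * (t * e 1 i) = 0"
      by (subst (asm) sum_nonneg_eq_0_iff) (use s t in auto)
    hence "{i. i < 5 \<and> 0 < s * e 0 i} \<inter> {i. i < 5 \<and> 0 < t * e 1 i} = {}" by fastforce
    thus ?thesis using part[of 0 s] part[of 1 t] s t by auto
  qed
  then obtain S R where SR: "good S" "good R" "S \<inter> R = {}" by blast
  have sub: "S \<subseteq> {..<5}" "R \<subseteq> {..<5}" using SR by (auto simp: good_def)
  have "card S + card R = card (S \<union> R)"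
    using SR(3) sub finite_subset by (intro card_Un_disjoint[symmetric]) blast+
  also have "\<dots> \<le> card {..<5::nat}" using sub by (intro card_mono) auto
  finally have "card S + card R \<le> 5" by simp
  hence "card S \<le> 2 \<or> card R \<le> 2" by linarith
  then obtain P where P: "good P" "card P \<le> 2" "P \<subseteq> {..<5}" using SR sub by blast
  obtain u where u: "P = {i. i < 5 \<and> 0 < u i}" "\<forall>i<5. 0 \<le> u i"
    "\<mu> 1 * (\<Sum>i<5. (u i)\<^sup>2) \<le> qform 5 a u" "P \<noteq> {}"
    using P(1) unfolding good_def by blast
  obtain p q where pq: "p < 5" "q < 5" "p \<noteq> q" "P \<subseteq> {p, q}" using subset_doubleton[OF P(3,2)] by auto
  \<comment> \<open>\<open>rayleigh_pair\<close> needs a vector vanishing at every natural number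
    outside \<open>{p, q}\<close>, whereas \<open>u\<close> is arbitrary from 5 on.\<close>
  define v where "v i = (if i < 5 then u i else 0)" for i
  have "v i = 0" if "i \<notin> {p, q}" for i
  proof (cases "i < 5")
    case True
    have "i \<notin> P" using that pq(4) by blast
    hence "\<not> 0 < u i" using u(1) True by blast
    moreover have "0 \<le> u i" using u(2) True by blast
    ultimately show ?thesis using True by (simp add: v_def)
  qed (simp add: v_def)
  moreover have "\<exists>i. v i \<noteq> 0"
  proof -
    obtain i where "i \<in> P" using u(4) by blast
    hence "i < 5" "0 < u i" using u(1) by blast+
    thus ?thesis by (intro exI[of _ i]) (simp add: v_def)
  qed
  moreover have "\<mu> 1 * (\<Sum>i<5. (v i)\<^sup>2) \<le> qform 5 a v" using u(3) by (simp add: v_def qform_def)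
  ultimately have "\<mu> 1 + \<nu> \<le> a p p + a q q"
    by (intro rayleigh_pair[OF pq(1-3), of v]) (use sym pq lower in auto)
  also have "a p p + a q q = (\<Sum>i\<in>{p, q}. a i i)" using pq by simp
  also have "\<dots> \<le> (\<Sum>i<5. a i i)" using pq a by (intro sum_mono2) auto
  finally show ?thesis .
qed

section \<open>Condition (3): a generic positive subspace\<close>

text \<open>
  Any pair of vectors with nonvanishing minors would do in place of \<open>(1, real i)\<close>.
\<close>
lemma generic_perturbation:
  fixes a b :: "nat \<Rightarrow> real"
  assumes "0 < \<epsilon>"
  obtains \<eta> where "0 < \<eta>" "\<eta> < \<epsilon>" "\<And>i. i < n \<Longrightarrow> a i + \<eta> \<noteq> 0"
    "\<And>i j. i < n \<Longrightarrow> j < n \<Longrightarrow> i \<noteq> j \<Longrightarrow> minor (\<lambda>i. a i + \<eta>) (\<lambda>i. b i + \<eta> * real i) i j \<noteq> 0"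
proof -
  define B where "B i j = {\<eta>. minor (\<lambda>i. a i + \<eta>) (\<lambda>i. b i + \<eta> * real i) i j = 0}" for i j
  have "finite (B i j)" if "i \<noteq> j" for i j
  proof -
    \<comment> \<open>As a function of \<open>\<eta>\<close> the minor is a quadratic polynomial
      with leading coefficient \<open>j - i\<close>, so it vanishes only finitely often.\<close>
    define P where "P = [: a i * b j - a j * b i, a i * real j + b j - a j * real i - b i, real j - real i :]"
    have "B i j = {\<eta>. poly P \<eta> = 0}"
      by (auto simp: B_def P_def minor_def algebra_simps)
    moreover have "P \<noteq> 0" using that by (simp add: P_def)
    ultimately show ?thesis using poly_roots_finite by metis
  qed
  hence "finite ((\<Union>i<n. \<Union>j\<in>{..<n} - {i}. B i j) \<union> (\<lambda>i. - a i) ` {..<n})" by auto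
  moreover have "infinite {0<..<\<epsilon>}" using assms by simp
  ultimately obtain \<eta> where \<eta>: "\<eta> \<in> {0<..<\<epsilon>}"
    "\<eta> \<notin> (\<Union>i<n. \<Union>j\<in>{..<n} - {i}. B i j) \<union> (\<lambda>i. - a i) ` {..<n}"
    by (meson finite_subset subsetI)
  show ?thesis
  proof (rule that[of \<eta>])
    show "a i + \<eta> \<noteq> 0" if "i < n" for i
    proof
      assume "a i + \<eta> = 0"
      hence "\<eta> = - a i" by simp
      thus False using \<eta>(2) that by blast
    qed
    show "minor (\<lambda>i. a i + \<eta>) (\<lambda>i. b i + \<eta> * real i) i j \<noteq> 0" if "i < n" "j < n" "i \<noteq> j" for i j
      using \<eta>(2) that by (auto simp: B_def)
  qed (use \<eta>(1) in auto)
qed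

lemma cauchy_schwarz_sum:
  fixes a x :: "'b \<Rightarrow> real"
  assumes "finite I"
  shows "(\<Sum>i\<in>I. a i * x i)\<^sup>2 \<le> (\<Sum>i\<in>I. (a i)\<^sup>2) * (\<Sum>i\<in>I. (x i)\<^sup>2)"
proof -
  define A where "A = (\<Sum>i\<in>I. (a i)\<^sup>2)"
  define S where "S = (\<Sum>i\<in>I. a i * x i)"
  have "0 \<le> (\<Sum>i\<in>I. (A * x i - S * a i)\<^sup>2)" by (rule sum_nonneg) simp
  also have "\<dots> = (\<Sum>i\<in>I. A\<^sup>2 * (x i)\<^sup>2 - 2 * A * S * (a i * x i) + S\<^sup>2 * (a i)\<^sup>2)"
    by (rule sum.cong) (auto simp: power2_eq_square algebra_simps)
  also have "\<dots> = A\<^sup>2 * (\<Sum>i\<in>I. (x i)\<^sup>2) - 2 * A * S * S + S\<^sup>2 * A"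
    by (simp add: sum.distrib sum_subtractf sum_distrib_left[symmetric] S_def A_def)
  finally have le: "A * S\<^sup>2 \<le> A * (A * (\<Sum>i\<in>I. (x i)\<^sup>2))" by (simp add: power2_eq_square algebra_simps)
  have "0 \<le> A" unfolding A_def by (rule sum_nonneg) simp
  show ?thesis
  proof (cases "A = 0")
    case True
    hence "\<forall>i\<in>I. a i = 0" using assms by (simp add: A_def sum_nonneg_eq_0_iff)
    thus ?thesis by simp
  next
    case False
    with \<open>0 \<le> A\<close> le show ?thesis by (simp add: A_def S_def)
  qed
qed

lemma third_eigenvalue_le_trace:
  fixes a e :: "nat \<Rightarrow> nat \<Rightarrow> real"
  assumes a: "\<And>i j. i < 5 \<Longrightarrow> j < 5 \<Longrightarrow> 0 \<le> a i j"
    and sym: "\<And>i j. i < 5 \<Longrightarrow> j < 5 \<Longrightarrow> a i j = a j i"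
    and norm: "\<And>x. (\<Sum>i<5. (x i)\<^sup>2) = (\<Sum>k<5. (\<Sum>i<5. e k i * x i)\<^sup>2)"
    and form: "\<And>x. qform 5 a x = (\<Sum>k<5. \<mu> k * (\<Sum>i<5. e k i * x i)\<^sup>2)"
    and dec: "\<mu> 0 \<ge> \<mu> 1" "\<mu> 1 \<ge> \<mu> 2" "\<mu> 2 \<ge> \<mu> 3" "\<mu> 3 \<ge> \<mu> 4"
    and half: "\<mu> 0 \<le> 2 * (\<Sum>i<5. a i i)"
  shows "\<mu> 2 \<le> (\<Sum>i<5. a i i)"
proof (rule ccontr)
  define t where "t = (\<Sum>i<5. a i i)"
  assume "\<not> \<mu> 2 \<le> (\<Sum>i<5. a i i)"
  then obtain T where T: "t < T" "T < \<mu> 2" using dense[of t "\<mu> 2"] by (auto simp: t_def)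
  define M where "M i j = a i j - (if i = j then T else 0)" for i j
  define c where "c k x = (\<Sum>i<5. e k i * x i)" for k and x :: "nat \<Rightarrow> real"
  have QM: "qform 5 M x = qform 5 a x - T * (\<Sum>i<5. (x i)\<^sup>2)" for x
  proof -
    have "(\<Sum>j<5. M i j * x i * x j) = (\<Sum>j<5. a i j * x i * x j) - T * (x i)\<^sup>2" if "i < 5" for i
    proof -
      have "(\<Sum>j<5. M i j * x i * x j) = (\<Sum>j<5. a i j * x i * x j - (if i = j then T * x i * x j else 0))"
        by (rule sum.cong) (auto simp: M_def algebra_simps)
      thus ?thesis using that by (simp add: sum_subtractf power2_eq_square)
    qed
    thus ?thesis by (simp add: qform_def sum_subtractf sum_distrib_left)
  qed
  \<comment> \<open>On the span of \<open>e 0\<close>, \<open>e 1\<close>, \<open>e 2\<close> the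
    form of \<open>M\<close> is at least \<open>\<kappa>\<close> times the squared length;
    \<open>C\<close> bounds what the components along \<open>e 3\<close> and \<open>e 4\<close> can
    take away from this.\<close>
  define \<kappa> where "\<kappa> = \<mu> 2 - T"
  define C where "C = \<mu> 2 - \<mu> 4"
  have \<kappa>: "0 < \<kappa>" and C: "0 \<le> C" using T dec by (simp_all add: \<kappa>_def C_def)
  have low: "\<kappa> * (\<Sum>i<5. (x i)\<^sup>2) - C * ((c 3 x)\<^sup>2 + (c 4 x)\<^sup>2) \<le> qform 5 M x" for x
  proof -
    have "\<mu> 2 * (c k x)\<^sup>2 \<le> \<mu> k * (c k x)\<^sup>2" if "k \<in> {0, 1, 2}" for k
      using that dec by (intro mult_right_mono) auto
    from this[of 0] this[of 1] have "\<mu> 2 * (c 0 x)\<^sup>2 \<le> \<mu> 0 * (c 0 x)\<^sup>2" "\<mu> 2 * (c 1 x)\<^sup>2 \<le> \<mu> 1 * (c 1 x)\<^sup>2"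
      by simp_all
    moreover have "\<mu> 4 * (c 3 x)\<^sup>2 \<le> \<mu> 3 * (c 3 x)\<^sup>2" using dec by (intro mult_right_mono) auto
    moreover have "(\<Sum>i<5. (x i)\<^sup>2) = (\<Sum>k<5. (c k x)\<^sup>2)" unfolding c_def by (rule norm)
    moreover have "qform 5 a x = (\<Sum>k<5. \<mu> k * (c k x)\<^sup>2)" unfolding c_def by (rule form)
    ultimately show ?thesis
      unfolding QM \<kappa>_def C_def by (simp add: sum_lessThan_5 algebra_simps)
  qed
  \<comment> \<open>The perturbing vectors \<open>(1, 1, 1, 1, 1)\<close> and
    \<open>(0, 1, 2, 3, 4)\<close> have squared lengths 5 and 30. By Cauchy-Schwarz, the components
    along \<open>e 3\<close> and \<open>e 4\<close> of a vector in the perturbed kernel cost at most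
    \<open>35 * C * \<eta>^2\<close> times its squared length. The bound 1 ensures
    \<open>\<eta>^2 \<le> \<eta>\<close>.\<close>
  define \<epsilon> where "\<epsilon> = min 1 (\<kappa> / (35 * C + 1))"
  have \<epsilon>: "0 < \<epsilon>" using \<kappa> C by (simp add: \<epsilon>_def)
  obtain \<eta> where \<eta>: "0 < \<eta>" "\<eta> < \<epsilon>" and f: "\<And>i. i < 5 \<Longrightarrow> e 3 i + \<eta> \<noteq> 0"
    and nz: "\<And>i j. i < 5 \<Longrightarrow> j < 5 \<Longrightarrow> i \<noteq> j \<Longrightarrow> minor (\<lambda>i. e 3 i + \<eta>) (\<lambda>i. e 4 i + \<eta> * real i) i j \<noteq> 0"
    using generic_perturbation[OF \<epsilon>, of 5 "e 3" "e 4"] by blast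
  have \<eta>\<kappa>: "35 * C * \<eta>\<^sup>2 < \<kappa>"
  proof -
    have "\<eta>\<^sup>2 \<le> \<eta>" using \<eta> by (simp add: power2_eq_square \<epsilon>_def mult_le_one)
    hence "35 * C * \<eta>\<^sup>2 \<le> 35 * C * \<eta>" using C by (intro mult_left_mono) auto
    also have "\<dots> < (35 * C + 1) * \<eta>" using \<eta> by simp
    also have "\<dots> < \<kappa>" using \<eta>(2) C by (simp add: \<epsilon>_def field_simps)
    finally show ?thesis .
  qed
  have pos: "0 < qform 5 M x" if x: "\<exists>i<5. x i \<noteq> 0"
    "(\<Sum>i<5. (e 3 i + \<eta>) * x i) = 0" "(\<Sum>i<5. (e 4 i + \<eta> * real i) * x i) = 0" for x
  proof -
    define N where "N = (\<Sum>i<5. (x i)\<^sup>2)"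
    have "N \<noteq> 0" using x(1) by (auto simp: N_def sum_nonneg_eq_0_iff)
    hence N: "0 < N" by (simp add: N_def sum_nonneg less_le)
    have "c 3 x + \<eta> * (\<Sum>i<5. 1 * x i) = 0"
      using x(2) by (simp add: c_def algebra_simps sum.distrib sum_distrib_left)
    hence "c 3 x = - \<eta> * (\<Sum>i<5. 1 * x i)" by simp
    hence "(c 3 x)\<^sup>2 = \<eta>\<^sup>2 * (\<Sum>i<5. 1 * x i)\<^sup>2" by (simp add: power_mult_distrib)
    also have "\<dots> \<le> \<eta>\<^sup>2 * ((\<Sum>i<5::nat. 1\<^sup>2) * N)"
      unfolding N_def by (intro mult_left_mono cauchy_schwarz_sum) auto
    finally have c3: "(c 3 x)\<^sup>2 \<le> 5 * \<eta>\<^sup>2 * N" by simp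
    have "c 4 x + \<eta> * (\<Sum>i<5. real i * x i) = 0"
      using x(3) by (simp add: c_def algebra_simps sum.distrib sum_distrib_left)
    hence "c 4 x = - \<eta> * (\<Sum>i<5. real i * x i)" by simp
    hence "(c 4 x)\<^sup>2 = \<eta>\<^sup>2 * (\<Sum>i<5. real i * x i)\<^sup>2" by (simp add: power_mult_distrib)
    also have "\<dots> \<le> \<eta>\<^sup>2 * ((\<Sum>i<5. (real i)\<^sup>2) * N)"
      unfolding N_def by (intro mult_left_mono cauchy_schwarz_sum) auto
    also have "(\<Sum>i<5. (real i)\<^sup>2) = 30" by (simp add: sum_lessThan_5)
    finally have "(c 3 x)\<^sup>2 + (c 4 x)\<^sup>2 \<le> 35 * \<eta>\<^sup>2 * N" using c3 by simp
    hence "C * ((c 3 x)\<^sup>2 + (c 4 x)\<^sup>2) \<le> C * (35 * \<eta>\<^sup>2 * N)" using C by (rule mult_left_mono)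
    also have "\<dots> = 35 * C * \<eta>\<^sup>2 * N" by simp
    also have "\<dots> < \<kappa> * N" using \<eta>\<kappa> N by (rule mult_strict_right_mono)
    finally show ?thesis using low[of x] by (simp add: N_def)
  qed
  have upper: "qform 5 M x \<le> (\<mu> 0 - T) * (\<Sum>i<5. (x i)\<^sup>2)" for x
  proof -
    have "\<mu> k \<le> \<mu> 0" if "k < 5" for k
      using that dec by (auto simp: eval_nat_numeral less_Suc_eq)
    hence "qform 5 a x \<le> (\<Sum>k<5. \<mu> 0 * (c k x)\<^sup>2)"
      unfolding form c_def by (intro sum_mono mult_right_mono) auto
    also have "\<dots> = \<mu> 0 * (\<Sum>i<5. (x i)\<^sup>2)"
      by (simp add: sum_distrib_left norm[of x] c_def)
    finally show ?thesis by (simp add: QM algebra_simps)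
  qed
  have diag_le: "a i i \<le> t" if "i < 5" for i
    unfolding t_def using that a by (intro member_le_sum) auto
  have diag_less: "a i i < T" if "i < 5" for i using diag_le[OF that] T by linarith
  have "T \<le> \<mu> 0 - T"
  proof (rule top_eigenvalue_bound[OF pos f nz _ _ _ _ _ upper])
    \<comment> \<open>The sum is \<open>5 * T - t\<close>, and \<open>t < T\<close>.\<close>
    show "4 * T \<le> (\<Sum>i<5. - M i i)"
      using T by (simp add: M_def sum_subtractf t_def)
  qed (use a sym diag_less in \<open>auto simp: M_def\<close>)
  \<comment> \<open>The chain is \<open>2 * t < 2 * T \<le> \<mu> 0 \<le> 2 * t\<close>.\<close>
  thus False using half T by (simp add: t_def)
qed

section \<open>Assembly of the equivalence from the realization and the three necessary
  conditions\<close>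

theorem theorem4:
  fixes l1 l2 l3 l4 l5 :: real and \<sigma> :: "real list"
  assumes "\<sigma> = [l1, l2, l3, l4, l5]"
    and "l1 \<ge> l2" and "l2 \<ge> l3" and "l3 \<ge> l4" and "l4 \<ge> l5"
    and "sum_list \<sigma> \<ge> 1 / 2 * l1"
  shows "(\<exists>A \<in> carrier_mat 5 5. nonnegative_mat A \<and> symmetric_mat A \<and> is_spectrum_of \<sigma> A) \<longleftrightarrow>
    l1 = Max {\<bar>l\<bar> | l. l \<in> set \<sigma>} \<and>
    l2 + l5 \<le> sum_list \<sigma> \<and>
    l3 \<le> sum_list \<sigma>"
proof -
  note \<sigma> = assms(1) and dec = assms(2-5)
  have sum: "sum_list \<sigma> = l1 + l2 + l3 + l4 + l5" by (simp add: \<sigma>)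
  have abs_set: "{\<bar>l\<bar> | l. l \<in> set \<sigma>} = abs ` set \<sigma>" by auto
  \<comment> \<open>In a decreasing list the largest absolute value is attained at an end, so (1)
    only compares \<open>l1\<close> with \<open>- l5\<close>.\<close>
  have Max_iff: "l1 = Max {\<bar>l\<bar> | l. l \<in> set \<sigma>} \<longleftrightarrow> - l5 \<le> l1"
  proof
    assume "l1 = Max {\<bar>l\<bar> | l. l \<in> set \<sigma>}"
    hence "\<bar>l5\<bar> \<le> l1" unfolding abs_set by (metis Max_ge \<sigma> finite_imageI finite_set imageI list.set_intros)
    thus "- l5 \<le> l1" by simp
  next
    assume "- l5 \<le> l1"
    with dec have "0 \<le> l1" "\<bar>l2\<bar> \<le> l1" "\<bar>l3\<bar> \<le> l1" "\<bar>l4\<bar> \<le> l1" "\<bar>l5\<bar> \<le> l1" by linarith+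
    thus "l1 = Max {\<bar>l\<bar> | l. l \<in> set \<sigma>}" unfolding abs_set
      by (intro Max_eqI[symmetric]) (auto simp: \<sigma>)
  qed
  show ?thesis
  proof
    assume "\<exists>A \<in> carrier_mat 5 5. nonnegative_mat A \<and> symmetric_mat A \<and> is_spectrum_of \<sigma> A"
    then obtain A where A: "A \<in> carrier_mat 5 5" and nn: "nonnegative_mat A" and sym: "symmetric_mat A"
      and spec: "is_spectrum_of \<sigma> A" by blast
    define a where "a i j = A $$ (i, j)" for i j
    have a: "0 \<le> a i j" "a i j = a j i" if "i < 5" "j < 5" for i j
    proof -
      show "0 \<le> a i j" using nn A that by (simp add: nonnegative_mat_def a_def)
      have "A\<^sup>T $$ (j, i) = a i j" using A that by (simp add: a_def)
      thus "a i j = a j i" using sym by (simp add: symmetric_mat_def a_def)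
    qed
    obtain e where "\<forall>k<5. \<forall>l<5. (\<Sum>i<5. e k i * e l i) = (if k = l then 1 else 0)"
      "\<forall>k<5. \<forall>i<5. (\<Sum>j<5. A $$ (i, j) * e k j) = \<sigma> ! k * e k i"
      "\<forall>x. (\<Sum>i<5. (x i)\<^sup>2) = (\<Sum>k<5. (\<Sum>i<5. e k i * x i)\<^sup>2)"
      "\<forall>x. qform 5 (\<lambda>i j. A $$ (i, j)) x = (\<Sum>k<5. \<sigma> ! k * (\<Sum>i<5. e k i * x i)\<^sup>2)"
      "(\<Sum>i<5. A $$ (i, i)) = sum_list \<sigma>"
      using spectral_decomposition[OF A sym spec] by (elim exE conjE) (rule that)
    note E = this[folded a_def] this(4)
    have a_eq: "a = (\<lambda>i j. A $$ (i, j))" by (simp add: a_def fun_eq_iff)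
    have on: "(\<Sum>i<5. e k i * e l i) = (if k = l then 1 else 0)" if "k < 5" "l < 5" for k l
      using E(1) that by blast
    have ev: "(\<Sum>j<5. a i j * e k j) = \<sigma> ! k * e k i" if "k < 5" "i < 5" for k i
      using E(2) that by blast
    have norm: "(\<Sum>i<5. (x i)\<^sup>2) = (\<Sum>k<5. (\<Sum>i<5. e k i * x i)\<^sup>2)" for x
      using E(3) by (rule HOL.spec)
    have form: "qform 5 a x = (\<Sum>k<5. \<sigma> ! k * (\<Sum>i<5. e k i * x i)\<^sup>2)" for x
      unfolding a_eq using E(6) by (rule HOL.spec)
    note tr = E(5)
    have range: "l5 \<le> \<sigma> ! k" "\<sigma> ! k \<le> l1" if "k < 5" for k
      using that dec by (auto simp: less_5 \<sigma>)
    have lower: "l5 * (\<Sum>i<5. (x i)\<^sup>2) \<le> qform 5 a x" for x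
      unfolding form norm[of x] sum_distrib_left by (intro sum_mono mult_right_mono range) auto
    have upper: "qform 5 a x \<le> l1 * (\<Sum>i<5. (x i)\<^sup>2)" for x
      unfolding form norm[of x] sum_distrib_left by (intro sum_mono mult_right_mono range) auto
    have "- l5 \<le> l1"
    proof -
      \<comment> \<open>Take a unit eigenvector for \<open>l5\<close>. At its absolute values the
        form is at least \<open>- l5\<close> because the entries of \<open>a\<close> are
        nonnegative, and at most \<open>l1\<close> as on every unit vector.\<close>
      have unit: "(\<Sum>i<5. (e 4 i)\<^sup>2) = 1" using on[of 4 4] by (simp add: power2_eq_square)
      have "qform 5 a (e 4) = (\<Sum>i<5. e 4 i * (\<Sum>j<5. a i j * e 4 j))"
        by (simp add: qform_def sum_distrib_left mult_ac)
      also have "\<dots> = (\<Sum>i<5. e 4 i * (l5 * e 4 i))" by (rule sum.cong) (auto simp: ev \<sigma>)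
      also have "\<dots> = l5 * (\<Sum>i<5. (e 4 i)\<^sup>2)" by (simp add: sum_distrib_left power2_eq_square mult_ac)
      finally have "qform 5 a (e 4) = l5" by (simp add: unit)
      moreover have "- qform 5 a (\<lambda>i. \<bar>e 4 i\<bar>) \<le> qform 5 a (e 4)" by (rule qform_abs_bound) (rule a)
      moreover have "qform 5 a (\<lambda>i. \<bar>e 4 i\<bar>) \<le> l1" using upper[of "\<lambda>i. \<bar>e 4 i\<bar>"] by (simp add: unit)
      ultimately show ?thesis by linarith
    qed
    moreover have "l2 + l5 \<le> sum_list \<sigma>"
    proof -
      have nz: "\<exists>i<5. e k i \<noteq> 0" if "k < 2" for k
      proof (rule ccontr)
        assume "\<not> (\<exists>i<5. e k i \<noteq> 0)"
        hence "(\<Sum>i<5. e k i * e k i) = 0" by simp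
        thus False using on[of k k] that by simp
      qed
      have "\<sigma> ! 1 + l5 \<le> (\<Sum>i<5. a i i)"
        by (rule second_plus_last_le_trace[of a e "(!) \<sigma>"])
          (use a on[of 0 1] nz ev lower dec in \<open>auto simp: \<sigma>\<close>)
      thus ?thesis by (simp add: tr \<sigma>)
    qed
    moreover have "l3 \<le> sum_list \<sigma>"
    proof -
      have "\<sigma> ! 2 \<le> (\<Sum>i<5. a i i)"
        by (rule third_eigenvalue_le_trace[of a e "(!) \<sigma>", OF a norm form])
          (use assms(6) dec in \<open>auto simp: \<sigma> tr\<close>)
      thus ?thesis by (simp add: tr \<sigma>)
    qed
    ultimately show "l1 = Max {\<bar>l\<bar> | l. l \<in> set \<sigma>} \<and> l2 + l5 \<le> sum_list \<sigma> \<and> l3 \<le> sum_list \<sigma>"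
      unfolding Max_iff by blast
  next
    assume "l1 = Max {\<bar>l\<bar> | l. l \<in> set \<sigma>} \<and> l2 + l5 \<le> sum_list \<sigma> \<and> l3 \<le> sum_list \<sigma>"
    hence c: "- l5 \<le> l1" "l2 + l5 \<le> sum_list \<sigma>" "l3 \<le> sum_list \<sigma>" unfolding Max_iff by auto
    \<comment> \<open>From \<open>- l5 \<le> l1\<close> and \<open>l5 \<le> l1\<close> follows
      \<open>0 \<le> l1\<close>, and the trace is at least half of \<open>l1\<close>.\<close>
    hence "0 \<le> sum_list \<sigma>" using assms(6) dec by linarith
    with c dec show "\<exists>A \<in> carrier_mat 5 5. nonnegative_mat A \<and> symmetric_mat A \<and> is_spectrum_of \<sigma> A"
      unfolding sum unfolding \<sigma> by (intro symmetric_nonnegative_realization) auto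
  qed
qed

end
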